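(* Let $E$ be a Polish space and let $\beta$ be the strict topology on $C_b(E)$. The locally convex space $(C_b(E),\beta)$ is strong Mackey, and together with the supremum norm it satisfies Condition C.
   Context: $C_b(E)$ is the space of bounded continuous functions on $E$. The strict topology $\beta$ on $C_b(E)$ is the locally convex topology generated by all semi-norms $p_{(K_n),(a_n)}(f):=\sup_na_n\sup_{x\in K_n}|f(x)|$, where $(K_n)$ ranges over sequences of compact subsets of $E$ and $(a_n)$ over sequences of non-negative reals with $a_n\to0$. A locally convex space $(X,\tau)$ with continuous dual $X'$ is strong Mackey if all $\sigma(X',X)$-compact sets in $X'$ are equi-continuous. $(X,\tau,\|\cdot\|)$ satisfies Condition C if: (a) $(X,\tau)$ is sequentially complete; (b) $\tau$ is weaker than the norm topology; (c) both topologies have the same bounded sets; (d) $\mathcal N$ is countably convex, where $\mathcal N$ is the set of $\tau$-continuous semi-norms $p$ with $p\le\|\cdot\|$, and countably convex means that for every sequence $p_n\in\mathcal N$ and $\alpha_n\ge0$ with $\sum_n\alpha_n=1$ one has $\sum_n\alpha_np_n\in\mathcal N$. *)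

theory Defs
  imports "HOL-Analysis.Analysis"
begin

section \<open>Locally convex topologies on a real vector space type\<close>

text \<open>A topology on a real vector space is a value of type \<^typ>\<open>'v topology\<close>, independent of the
  topology that the type class of \<^typ>\<open>'v\<close> may provide. Hausdorffness is not part of the definition.\<close>

definition locally_convex_space :: "'v::real_vector topology \<Rightarrow> bool" where
  "locally_convex_space \<tau> \<longleftrightarrow>
     topspace \<tau> = UNIV \<and>
     continuous_map (prod_topology \<tau> \<tau>) \<tau> (\<lambda>(x, y). x + y) \<and>
     continuous_map (prod_topology euclideanreal \<tau>) \<tau> (\<lambda>(c, x). c *\<^sub>R x) \<and>
     (\<forall>U. openin \<tau> U \<and> 0 \<in> U \<longrightarrow> (\<exists>V. openin \<tau> V \<and> 0 \<in> V \<and> convex V \<and> V \<subseteq> U))"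

definition seminorm :: "('v::real_vector \<Rightarrow> real) \<Rightarrow> bool" where
  "seminorm p \<longleftrightarrow>
     (\<forall>x. 0 \<le> p x) \<and>
     (\<forall>x y. p (x + y) \<le> p x + p y) \<and>
     (\<forall>c x. p (c *\<^sub>R x) = \<bar>c\<bar> * p x)"

definition seminorm_topology :: "('v::real_vector \<Rightarrow> real) set \<Rightarrow> 'v topology" where
  "seminorm_topology P = topology_generated_by {{y. p (y - x) < r} | p x r. p \<in> P \<and> 0 < r}"

definition continuous_dual :: "'v::real_vector topology \<Rightarrow> ('v \<Rightarrow> real) set" where
  "continuous_dual \<tau> = {\<phi>. linear \<phi> \<and> continuous_map \<tau> euclideanreal \<phi>}"

text \<open>The topology \<open>\<sigma>(X', X)\<close> on the dual is that of pointwise convergence on \<open>X\<close>, i.e. the trace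
  on \<open>X'\<close> of the product topology on all functions from \<open>X\<close> to the reals.\<close>

definition weak_star_topology :: "'v::real_vector topology \<Rightarrow> ('v \<Rightarrow> real) topology" where
  "weak_star_topology \<tau> = subtopology (powertop_real UNIV) (continuous_dual \<tau>)"

definition equicontinuous :: "'v::real_vector topology \<Rightarrow> ('v \<Rightarrow> real) set \<Rightarrow> bool" where
  "equicontinuous \<tau> H \<longleftrightarrow>
     (\<forall>x. \<forall>e>0. \<exists>U. openin \<tau> U \<and> x \<in> U \<and> (\<forall>\<phi>\<in>H. \<forall>y\<in>U. \<bar>\<phi> y - \<phi> x\<bar> < e))"

definition strong_mackey :: "'v::real_vector topology \<Rightarrow> bool" where
  "strong_mackey \<tau> \<longleftrightarrow>
     locally_convex_space \<tau> \<and>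
     (\<forall>H. compactin (weak_star_topology \<tau>) H \<longrightarrow> equicontinuous \<tau> H)"


section \<open>Condition C\<close>

definition tvs_Cauchy :: "'v::real_vector topology \<Rightarrow> (nat \<Rightarrow> 'v) \<Rightarrow> bool" where
  "tvs_Cauchy \<tau> s \<longleftrightarrow>
     (\<forall>U. openin \<tau> U \<and> 0 \<in> U \<longrightarrow> (\<exists>N. \<forall>m\<ge>N. \<forall>n\<ge>N. s m - s n \<in> U))"

definition sequentially_complete :: "'v::real_vector topology \<Rightarrow> bool" where
  "sequentially_complete \<tau> \<longleftrightarrow> (\<forall>s. tvs_Cauchy \<tau> s \<longrightarrow> (\<exists>l. limitin \<tau> s l sequentially))"

text \<open>Boundedness in the sense of topological vector spaces: absorbed by every neighbourhood of 0.\<close>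

definition tvs_bounded :: "'v::real_vector topology \<Rightarrow> 'v set \<Rightarrow> bool" where
  "tvs_bounded \<tau> B \<longleftrightarrow>
     (\<forall>U. openin \<tau> U \<and> 0 \<in> U \<longrightarrow> (\<exists>s>0. \<forall>t>s. B \<subseteq> (\<lambda>x. t *\<^sub>R x) ` U))"

definition dominated_seminorms :: "'v::real_normed_vector topology \<Rightarrow> ('v \<Rightarrow> real) set" where
  "dominated_seminorms \<tau> =
     {p. seminorm p \<and> continuous_map \<tau> euclideanreal p \<and> (\<forall>x. p x \<le> norm x)}"

text \<open>The series below is the usual infinite sum only where it converges; for sets of seminorms
  dominated by the norm it converges at every point.\<close>

definition countably_convex :: "('v \<Rightarrow> real) set \<Rightarrow> bool" where
  "countably_convex N \<longleftrightarrow>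
     (\<forall>p \<alpha>. (\<forall>n::nat. p n \<in> N) \<and> (\<forall>n. 0 \<le> \<alpha> n) \<and> \<alpha> sums 1 \<longrightarrow> (\<lambda>x. \<Sum>n. \<alpha> n * p n x) \<in> N)"

definition condition_C :: "'v::real_normed_vector topology \<Rightarrow> bool" where
  "condition_C \<tau> \<longleftrightarrow>
     locally_convex_space \<tau> \<and>
     sequentially_complete \<tau> \<and>
     (\<forall>U. openin \<tau> U \<longrightarrow> open U) \<and>
     (\<forall>B. tvs_bounded \<tau> B \<longleftrightarrow> bounded B) \<and>
     countably_convex (dominated_seminorms \<tau>)"


section \<open>The strict topology\<close>

text \<open>The norm on \<^typ>\<open>'a \<Rightarrow>\<^sub>C real\<close> is the supremum norm. Inserting 0 makes the inner supremum 0 when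
  \<open>K n\<close> is empty and changes nothing otherwise.\<close>

definition strict_seminorm ::
    "(nat \<Rightarrow> 'a::topological_space set) \<Rightarrow> (nat \<Rightarrow> real) \<Rightarrow> ('a \<Rightarrow>\<^sub>C real) \<Rightarrow> real" where
  "strict_seminorm K a f =
     (SUP n. a n * Sup (insert 0 ((\<lambda>x. \<bar>apply_bcontfun f x\<bar>) ` K n)))"

definition strict_topology :: "('a::topological_space \<Rightarrow>\<^sub>C real) topology" where
  "strict_topology = seminorm_topology
     {strict_seminorm K a | K a. (\<forall>n. compact (K n)) \<and> (\<forall>n. 0 \<le> a n) \<and> a \<longlonglongrightarrow> 0}"

end

theory Submission
  imports Defs
begin

text \<open>A norm-bounded set of functionals (or a seminorm) is controlled by a strict seminorm as soon as it is
  uniformly tight, i.e. uniformly small on unit vectors vanishing on a suitable compact set: one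
  splits \<open>f\<close> into the differences of its truncations at the heights \<open>2\<^sup>n c\<close>, which vanish on the
  compact sets where \<open>f\<close> is small. Tightness passes to countable convex combinations, which is
  part (d) of Condition C.

  For the strong Mackey property, a weak-star compact \<open>H\<close> is norm bounded by Banach-Steinhaus. If
  for some \<open>e, d > 0\<close> no finite set \<open>F\<close> made \<open>H\<close> at most \<open>e\<close> on unit vectors vanishing
  on the \<open>d\<close>-neighbourhood of \<open>F\<close>, there would be functions \<open>g\<^sub>k\<close> with uniformly separated
  supports and \<open>\<phi>\<^sub>k\<close> in \<open>H\<close> with \<open>\<bar>\<phi>\<^sub>k g\<^sub>k\<bar> > e/2\<close>; then \<open>A \<mapsto> \<phi> (\<Sum>k\<in>A. g\<^sub>k)\<close> are
  measures on the natural numbers that are compact for setwise convergence, contradicting Phillips'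
  lemma. Intersecting the neighbourhoods of such finite sets for \<open>d, e\<close> tending to 0 gives the compact
  set that witnesses tightness.\<close>

text \<open>A single continuous functional is tight because a strict seminorm dominates it; the
  difficulty is a compact set \<open>K\<close> that serves all of \<open>H\<close>. The finite sets
  control functions that vanish on a whole neighbourhood, whereas tightness concerns functions that
  vanish only on \<open>K\<close>, and \<open>K\<close> need not have compact neighbourhoods. The
  gap is closed by multiplying \<open>f\<close> successively by cutoffs around the finite sets. The
  cost of all the factors is summable and uniform in \<open>H\<close>; what remains is handled by a
  compact set \<open>L\<close> belonging to the individual functional, on which finitely many
  factors already make the product small. The number of factors may depend on \<open>f\<close> and
  on the functional, but \<open>K\<close> does not.

  Weak-star compactness lives in a product over all of the function space, so a sequence has cluster
  points but not necessarily convergent subsequences; the gliding hump is therefore built around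
  cluster points and finitely many coordinates. Completeness of the space enters where a closed,
  totally bounded intersection is recognised as compact.\<close>

section \<open>Elementary inequalities for seminorms\<close>

lemma seminorm_zero: "seminorm p \<Longrightarrow> p 0 = 0"
  unfolding seminorm_def by (metis abs_zero mult_zero_left scaleR_zero_left)

lemma seminorm_minus: "seminorm p \<Longrightarrow> p (- x) = p x"
  unfolding seminorm_def by (metis abs_minus_cancel abs_one mult_1 scaleR_minus1_left)

lemma seminorm_triangle: "seminorm p \<Longrightarrow> p (x + y) \<le> p x + p y"
  by (simp add: seminorm_def)

lemma seminorm_nonneg: "seminorm p \<Longrightarrow> 0 \<le> p x"
  by (simp add: seminorm_def)

lemma seminorm_scaleR: "seminorm p \<Longrightarrow> p (c *\<^sub>R x) = \<bar>c\<bar> * p x"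
  by (simp add: seminorm_def)

lemma seminorm_diff_triangle:
  assumes "seminorm p"
  shows "p (x - z) \<le> p (x - y) + p (y - z)"
  using seminorm_triangle[OF assms, of "x - y" "y - z"] by simp

lemma seminorm_diff_commute: "seminorm p \<Longrightarrow> p (x - y) = p (y - x)"
  using seminorm_minus[of p "x - y"] by simp

lemma seminorm_abs_diff_le:
  assumes "seminorm p"
  shows "\<bar>p x - p y\<bar> \<le> p (x - y)"
  using seminorm_diff_triangle[OF assms, of x 0 y] seminorm_diff_triangle[OF assms, of y 0 x]
    seminorm_diff_commute[OF assms, of x y] by simp

lemma seminorm_sum_le:
  assumes "seminorm p"
  shows "p (sum f A) \<le> (\<Sum>i\<in>A. p (f i))"
proof (induction A rule: infinite_finite_induct)
  case (insert i A)
  then show ?case using seminorm_triangle[OF assms, of "f i" "sum f A"] by simp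
qed (simp_all add: seminorm_zero[OF assms])

subsection \<open>Topologies generated by directed families of seminorms\<close>

text \<open>In \<open>seminorm_topology\<close> the balls form only a subbase; directedness makes
  them a base, so that a neighbourhood can be tested with a single seminorm.\<close>

definition directed_seminorms :: "('v::real_vector \<Rightarrow> real) set \<Rightarrow> bool" where
  "directed_seminorms P \<longleftrightarrow>
     P \<noteq> {} \<and> (\<forall>p\<in>P. seminorm p) \<and>
     (\<forall>p\<in>P. \<forall>q\<in>P. \<exists>r\<in>P. \<forall>x. p x \<le> r x \<and> q x \<le> r x)"

lemma directed_seminormsD: "directed_seminorms P \<Longrightarrow> p \<in> P \<Longrightarrow> seminorm p"
  by (simp add: directed_seminorms_def)

lemma openin_seminorm_topology_ball:
  assumes "p \<in> P" "0 < r"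
  shows "openin (seminorm_topology P) {y. p (y - x) < r}"
  unfolding seminorm_topology_def by (rule topology_generated_by_Basis) (use assms in blast)

text \<open>Two balls around a point contain a ball of a common majorant, and a ball centred
  elsewhere contains, by the triangle inequality, a ball around each of its points. Induction over
  the generation of open sets needs nothing else.\<close>

lemma openin_seminorm_topology:
  assumes P: "directed_seminorms P"
  shows "openin (seminorm_topology P) U \<longleftrightarrow>
    (\<forall>x\<in>U. \<exists>p\<in>P. \<exists>r>0. {y. p (y - x) < r} \<subseteq> U)"
proof
  assume R: "\<forall>x\<in>U. \<exists>p\<in>P. \<exists>r>0. {y. p (y - x) < r} \<subseteq> U"
  show "openin (seminorm_topology P) U"
  proof (subst openin_subopen, intro ballI)
    fix x assume "x \<in> U"
    then obtain p r where p: "p \<in> P" "0 < r" "{y. p (y - x) < r} \<subseteq> U" using R by blast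
    moreover have "x \<in> {y. p (y - x) < r}"
      using p by (simp add: seminorm_zero[OF directed_seminormsD[OF P]])
    ultimately show "\<exists>T. openin (seminorm_topology P) T \<and> x \<in> T \<and> T \<subseteq> U"
      using openin_seminorm_topology_ball[OF p(1,2), of x] p(3)
      by (intro exI[of _ "{y. p (y - x) < r}"]) simp
  qed
next
  assume "openin (seminorm_topology P) U"
  then have "generate_topology_on {{y. p (y - x) < r} | p x r. p \<in> P \<and> 0 < r} U"
    by (simp add: seminorm_topology_def openin_topology_generated_by_iff)
  then show "\<forall>x\<in>U. \<exists>p\<in>P. \<exists>r>0. {y. p (y - x) < r} \<subseteq> U"
  proof induction
    case Empty
    then show ?case by simp
  next
    case (Int A B)
    show ?case
    proof
      fix x assume "x \<in> A \<inter> B"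
      then obtain p r q s where *: "p \<in> P" "0 < r" "{y. p (y - x) < r} \<subseteq> A"
        "q \<in> P" "0 < s" "{y. q (y - x) < s} \<subseteq> B" using Int.IH by (meson IntD1 IntD2)
      then obtain u where u: "u \<in> P" "\<And>x. p x \<le> u x" "\<And>x. q x \<le> u x"
        using P unfolding directed_seminorms_def by meson
      have "{y. u (y - x) < min r s} \<subseteq> A \<inter> B"
      proof
        fix y assume "y \<in> {y. u (y - x) < min r s}"
        then have "p (y - x) < r" "q (y - x) < s"
          using u(2)[of "y - x"] u(3)[of "y - x"] by auto
        then show "y \<in> A \<inter> B" using * by auto
      qed
      moreover have "0 < min r s" using * by simp
      ultimately show "\<exists>p\<in>P. \<exists>r>0. {y. p (y - x) < r} \<subseteq> A \<inter> B"
        using u(1) by blast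
    qed
  next
    case (UN K)
    show ?case
    proof
      fix x assume "x \<in> \<Union>K"
      then obtain k where k: "k \<in> K" "x \<in> k" by blast
      then obtain p r where "p \<in> P" "0 < r" "{y. p (y - x) < r} \<subseteq> k" using UN.IH by blast
      then show "\<exists>p\<in>P. \<exists>r>0. {y. p (y - x) < r} \<subseteq> \<Union>K" using k by blast
    qed
  next
    case (Basis s)
    then obtain p z r where s: "s = {y. p (y - z) < r}" "p \<in> P" "0 < r" by blast
    have sp: "seminorm p" by (rule directed_seminormsD[OF P s(2)])
    show ?case
    proof
      fix x assume "x \<in> s"
      then have "0 < r - p (x - z)" using s by simp
      moreover have "{y. p (y - x) < r - p (x - z)} \<subseteq> s"
      proof
        fix y assume "y \<in> {y. p (y - x) < r - p (x - z)}"
        then show "y \<in> s" using seminorm_diff_triangle[OF sp, of y z x] s(1) by simp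
      qed
      ultimately show "\<exists>p\<in>P. \<exists>r>0. {y. p (y - x) < r} \<subseteq> s" using s by blast
    qed
  qed
qed

lemma topspace_seminorm_topology:
  assumes "directed_seminorms P"
  shows "topspace (seminorm_topology P) = UNIV"
proof -
  have "openin (seminorm_topology P) UNIV"
    unfolding openin_seminorm_topology[OF assms]
    using assms by (auto simp: directed_seminorms_def intro: zero_less_one)
  then show ?thesis using openin_subset by blast
qed

lemma openin_seminorm_topology_0:
  assumes "directed_seminorms P" "openin (seminorm_topology P) U" "0 \<in> U"
  obtains p r where "p \<in> P" "0 < r" "{y. p y < r} \<subseteq> U"
  using assms by (force simp: openin_seminorm_topology)

lemma convex_seminorm_ball:
  assumes p: "seminorm p"
  shows "convex {y. p y < r}"
proof (rule convexI, simp)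
  fix x y and u v :: real
  assume *: "p x < r" "p y < r" "0 \<le> u" "0 \<le> v" "u + v = 1"
  have "p (u *\<^sub>R x + v *\<^sub>R y) \<le> u * p x + v * p y"
    using seminorm_triangle[OF p, of "u *\<^sub>R x" "v *\<^sub>R y"] * by (simp add: seminorm_scaleR[OF p])
  also have "\<dots> < r" using * by (intro convex_bound_lt) auto
  finally show "p (u *\<^sub>R x + v *\<^sub>R y) < r" .
qed

lemma locally_convex_seminorm_topology:
  assumes P: "directed_seminorms P"
  shows "locally_convex_space (seminorm_topology P)"
proof -
  let ?T = "seminorm_topology P"
  have top: "topspace ?T = UNIV" by (rule topspace_seminorm_topology[OF P])
  have sn: "\<And>p. p \<in> P \<Longrightarrow> seminorm p" by (rule directed_seminormsD[OF P])
  have "continuous_map (prod_topology ?T ?T) ?T (\<lambda>(x, y). x + y)"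
    unfolding continuous_map_alt
  proof (intro conjI allI impI)
    fix U assume U: "openin ?T U"
    show "openin (prod_topology ?T ?T) ((\<lambda>(x, y). x + y) -` U \<inter> topspace (prod_topology ?T ?T))"
      unfolding openin_prod_topology_alt
    proof (intro allI impI)
      fix x y assume "(x, y) \<in> (\<lambda>(x, y). x + y) -` U \<inter> topspace (prod_topology ?T ?T)"
      then have "x + y \<in> U" by simp
      then obtain p r where p: "p \<in> P" "0 < r" "{z. p (z - (x + y)) < r} \<subseteq> U"
        using U unfolding openin_seminorm_topology[OF P] by blast
      let ?V = "\<lambda>x. {z. p (z - x) < r / 2}"
      have "?V x \<times> ?V y \<subseteq> (\<lambda>(x, y). x + y) -` U \<inter> topspace (prod_topology ?T ?T)"
      proof (clarsimp simp: top)
        fix a b assume ab: "p (a - x) * 2 < r" "p (b - y) * 2 < r"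
        have "p (a + b - (x + y)) \<le> p (a - x) + p (b - y)"
          using seminorm_triangle[OF sn[OF p(1)], of "a - x" "b - y"] by (simp add: algebra_simps)
        then show "a + b \<in> U" using ab p(3) by auto
      qed
      moreover have "openin ?T (?V x)" "openin ?T (?V y)"
        using p openin_seminorm_topology_ball[of p P "r / 2"] by simp_all
      moreover have "x \<in> ?V x" "y \<in> ?V y" using p by (auto simp: seminorm_zero[OF sn])
      ultimately show "\<exists>V W. openin ?T V \<and> openin ?T W \<and> x \<in> V \<and> y \<in> W \<and>
          V \<times> W \<subseteq> (\<lambda>(x, y). x + y) -` U \<inter> topspace (prod_topology ?T ?T)" by blast
    qed
  qed (simp add: top)
  moreover have "continuous_map (prod_topology euclideanreal ?T) ?T (\<lambda>(c, x). c *\<^sub>R x)"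
    unfolding continuous_map_alt
  proof (intro conjI allI impI)
    let ?E = "prod_topology euclideanreal ?T"
    fix U assume U: "openin ?T U"
    show "openin ?E ((\<lambda>(c, x). c *\<^sub>R x) -` U \<inter> topspace ?E)"
      unfolding openin_prod_topology_alt
    proof (intro allI impI)
      fix c x assume "(c, x) \<in> (\<lambda>(c, x). c *\<^sub>R x) -` U \<inter> topspace ?E"
      then have "c *\<^sub>R x \<in> U" by simp
      then obtain p r where p: "p \<in> P" "0 < r" "{z. p (z - c *\<^sub>R x) < r} \<subseteq> U"
        using U unfolding openin_seminorm_topology[OF P] by blast
      note sp = sn[OF p(1)]
      \<comment> \<open>The error splits as
        \<open>\<bar>b\<bar> * p (z - x) + \<bar>b - c\<bar> * p x\<close>, and each half gets
        \<open>r / 2\<close>. The minimum with 1 gives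
        \<open>\<bar>b\<bar> \<le> \<bar>c\<bar> + 1\<close>; adding 1 to \<open>p x\<close> keeps
        the denominator positive.\<close>
      define d where "d = min 1 (r / (2 * (p x + 1)))"
      define e where "e = r / (2 * (\<bar>c\<bar> + 1))"
      have px: "0 \<le> p x" by (rule seminorm_nonneg[OF sp])
      have d: "0 < d" "d \<le> 1" using p(2) px by (auto simp: d_def)
      have "d * (p x + 1) \<le> r / (2 * (p x + 1)) * (p x + 1)"
        using px by (intro mult_right_mono) (auto simp: d_def)
      also have "r / (2 * (p x + 1)) * (p x + 1) = r / 2" using px by (simp add: divide_simps)
      finally have d3: "d * (p x + 1) \<le> r / 2" .
      have "\<bar>c\<bar> + 1 \<noteq> 0" by linarith
      then have e: "0 < e" "(\<bar>c\<bar> + 1) * e = r / 2" using p(2) by (auto simp: e_def divide_simps)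
      have "ball c d \<times> {z. p (z - x) < e} \<subseteq> (\<lambda>(c, x). c *\<^sub>R x) -` U \<inter> topspace ?E"
      proof (clarsimp simp: top)
        fix b z assume b: "dist c b < d" and z: "p (z - x) < e"
        have "p (b *\<^sub>R z - c *\<^sub>R x) \<le> p (b *\<^sub>R (z - x)) + p ((b - c) *\<^sub>R x)"
          using seminorm_triangle[OF sp, of "b *\<^sub>R (z - x)" "(b - c) *\<^sub>R x"]
          by (simp add: algebra_simps)
        also have "\<dots> = \<bar>b\<bar> * p (z - x) + \<bar>b - c\<bar> * p x" by (simp add: seminorm_scaleR[OF sp])
        also have "\<dots> \<le> (\<bar>c\<bar> + 1) * p (z - x) + d * p x"
          using b d(2) px seminorm_nonneg[OF sp, of "z - x"]
          by (intro add_mono mult_right_mono) (auto simp: dist_real_def)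
        also have "\<dots> < (\<bar>c\<bar> + 1) * e + d * (p x + 1)"
          using z d px by (intro add_strict_mono mult_strict_left_mono) auto
        also have "\<dots> \<le> r" using d3 e(2) by simp
        finally show "b *\<^sub>R z \<in> U" using p(3) by auto
      qed
      moreover have "openin ?T {z. p (z - x) < e}" "x \<in> {z. p (z - x) < e}"
        using p e by (auto intro: openin_seminorm_topology_ball simp: seminorm_zero[OF sp])
      moreover have "openin euclideanreal (ball c d)" "c \<in> ball c d" using d by auto
      ultimately show "\<exists>V W. openin euclideanreal V \<and> openin ?T W \<and> c \<in> V \<and> x \<in> W \<and>
          V \<times> W \<subseteq> (\<lambda>(c, x). c *\<^sub>R x) -` U \<inter> topspace ?E" by blast
    qed
  qed (simp add: top)
  moreover have "\<exists>V. openin ?T V \<and> 0 \<in> V \<and> convex V \<and> V \<subseteq> U" if U: "openin ?T U" "0 \<in> U" for U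
  proof -
    obtain p r where p: "p \<in> P" "0 < r" "{y. p y < r} \<subseteq> U"
      using openin_seminorm_topology_0[OF P U] .
    then show ?thesis
      using openin_seminorm_topology_ball[of p P r 0] convex_seminorm_ball[OF sn[OF p(1)], of r]
      by (intro exI[of _ "{y. p y < r}"]) (auto simp: seminorm_zero[OF sn])
  qed
  ultimately show ?thesis using top by (auto simp: locally_convex_space_def)
qed

lemma continuous_map_seminorm:
  assumes P: "directed_seminorms P" and q: "seminorm q" and p: "p \<in> P" and le: "\<And>x. q x \<le> p x"
  shows "continuous_map (seminorm_topology P) euclideanreal q"
  unfolding continuous_map_alt
proof (intro conjI allI impI)
  fix U assume "openin euclideanreal U"
  then have U: "open U" by simp
  show "openin (seminorm_topology P) (q -` U \<inter> topspace (seminorm_topology P))"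
    unfolding openin_seminorm_topology[OF P] topspace_seminorm_topology[OF P]
  proof
    fix x assume "x \<in> q -` U \<inter> UNIV"
    then obtain e where e: "0 < e" "ball (q x) e \<subseteq> U" using U by (auto elim: openE)
    have "\<bar>q y - q x\<bar> < e" if "p (y - x) < e" for y
      using seminorm_abs_diff_le[OF q, of y x] le[of "y - x"] that by simp
    then have "{y. p (y - x) < e} \<subseteq> q -` U \<inter> UNIV"
      using e(2) by (auto simp: subset_iff dist_real_def abs_minus_commute)
    then show "\<exists>p\<in>P. \<exists>r>0. {y. p (y - x) < r} \<subseteq> q -` U \<inter> UNIV" using p e by blast
  qed
qed simp

text \<open>By homogeneity, the inclusion of a ball of \<open>p\<close> in the unit ball of
  \<open>q\<close> becomes an inequality between the two seminorms.\<close>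

lemma continuous_seminorm_dominated:
  assumes P: "directed_seminorms P" and q: "seminorm q"
    and cont: "continuous_map (seminorm_topology P) euclideanreal q"
  obtains p C where "p \<in> P" "0 < C" "\<And>x. q x \<le> C * p x"
proof -
  have "openin (seminorm_topology P) {x \<in> topspace (seminorm_topology P). q x \<in> {..<1}}"
    by (rule openin_continuous_map_preimage[OF cont]) simp
  then have "openin (seminorm_topology P) {x. q x < 1}"
    by (simp add: topspace_seminorm_topology[OF P])
  moreover have "0 \<in> {x. q x < 1}" using seminorm_zero[OF q] by simp
  ultimately obtain p r where p: "p \<in> P" "0 < r" "{y. p y < r} \<subseteq> {x. q x < 1}"
    using openin_seminorm_topology_0[OF P] by metis
  have sp: "seminorm p" by (rule directed_seminormsD[OF P p(1)])
  have "q x \<le> (2 / r) * p x" for x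
  proof (rule field_le_epsilon)
    fix e :: real assume e: "0 < e"
    \<comment> \<open>The vector \<open>x\<close> is scaled into the ball of radius
      \<open>r\<close>. Since \<open>p x\<close> may be 0, the summand \<open>r * e\<close> keeps
      the factor finite; it reappears as the error \<open>e\<close> in \<open>1 / c\<close>.\<close>
    define c where "c = r / (2 * p x + r * e)"
    have px: "0 \<le> p x" by (rule seminorm_nonneg[OF sp])
    have den: "0 < 2 * p x + r * e" using px p e by (simp add: add_nonneg_pos)
    have c: "0 < c" using den p by (simp add: c_def)
    have "r * p x < r * (2 * p x + r * e)"
      using px p e by (intro mult_strict_left_mono) (auto intro: add_nonneg_pos)
    then have "p (c *\<^sub>R x) < r"
      using den c by (simp add: seminorm_scaleR[OF sp], simp add: c_def field_simps)
    then have "q (c *\<^sub>R x) < 1" using p by auto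
    then have "q x < 1 / c" using c by (simp add: seminorm_scaleR[OF q] field_simps)
    also have "1 / c = 2 / r * p x + e" using den p by (simp add: c_def field_simps)
    finally show "q x \<le> 2 / r * p x + e" by simp
  qed
  then show ?thesis using that[of p "2 / r"] p by simp
qed

subsection \<open>Seminorms of the strict topology\<close>

definition strict_seminorms :: "(('a::topological_space \<Rightarrow>\<^sub>C real) \<Rightarrow> real) set" where
  "strict_seminorms = {strict_seminorm K a | K a. (\<forall>n. compact (K n)) \<and> (\<forall>n. 0 \<le> a n) \<and> a \<longlonglongrightarrow> 0}"

lemma strict_topology_eq: "strict_topology = seminorm_topology strict_seminorms"
  by (simp add: strict_topology_def strict_seminorms_def)

lemma abs_bcontfun_le_norm: "\<bar>apply_bcontfun f x\<bar> \<le> norm f" for f :: "'a::topological_space \<Rightarrow>\<^sub>C real"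
  using norm_bounded[of f x] by simp

text \<open>Both suprema are finite because \<open>f\<close> and the convergent sequence
  \<open>a\<close> are bounded, so the double supremum can be replaced by a pointwise condition, the
  form used in the later estimates. The 0 inserted into the inner supremum forces \<open>c\<close>
  to be nonnegative.\<close>

lemma strict_seminorm_le_iff:
  assumes a: "\<And>n. 0 \<le> a n" "a \<longlonglongrightarrow> 0" and c: "0 \<le> c"
  shows "strict_seminorm K a f \<le> c \<longleftrightarrow> (\<forall>n. \<forall>x\<in>K n. a n * \<bar>apply_bcontfun f x\<bar> \<le> c)"
proof -
  define S where "S n = insert 0 ((\<lambda>x. \<bar>apply_bcontfun f x\<bar>) ` K n)" for n
  have bdd: "bdd_above (S n)" for n
    unfolding S_def by (rule bdd_aboveI[where M = "norm f"]) (auto simp: abs_bcontfun_le_norm)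
  have S: "Sup (S n) \<le> norm f" for n
    by (rule cSup_least) (auto simp: S_def abs_bcontfun_le_norm)
  have "Bseq a" using a(2) by (rule convergent_imp_Bseq[OF convergentI])
  then obtain A where A: "0 < A" "\<And>n. a n \<le> A"
    unfolding Bseq_def by (metis abs_le_D1 real_norm_def)
  have "bdd_above (range (\<lambda>n. a n * Sup (S n)))"
  proof (rule bdd_aboveI[where M = "A * norm f"])
    fix t assume "t \<in> range (\<lambda>n. a n * Sup (S n))"
    then obtain n where t: "t = a n * Sup (S n)" by blast
    also have "\<dots> \<le> a n * norm f" using S a(1) by (intro mult_left_mono)
    also have "\<dots> \<le> A * norm f" using A by (intro mult_right_mono) auto
    finally show "t \<le> A * norm f" .
  qed
  then have "strict_seminorm K a f \<le> c \<longleftrightarrow> (\<forall>n. a n * Sup (S n) \<le> c)"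
    unfolding strict_seminorm_def S_def[symmetric] by (subst cSUP_le_iff) auto
  moreover have "a n * Sup (S n) \<le> c \<longleftrightarrow> (\<forall>x\<in>K n. a n * \<bar>apply_bcontfun f x\<bar> \<le> c)" for n
  proof (cases "a n = 0")
    case False
    then have an: "0 < a n" using a(1)[of n] by simp
    then have "a n * Sup (S n) \<le> c \<longleftrightarrow> Sup (S n) \<le> c / a n" by (simp add: field_simps)
    also have "\<dots> \<longleftrightarrow> (\<forall>t\<in>S n. t \<le> c / a n)"
      by (rule cSup_le_iff) (use bdd in \<open>auto simp: S_def\<close>)
    also have "\<dots> \<longleftrightarrow> (\<forall>x\<in>K n. a n * \<bar>apply_bcontfun f x\<bar> \<le> c)"
      using an c by (auto simp: S_def field_simps)
    finally show ?thesis .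
  qed (use c in simp)
  ultimately show ?thesis by simp
qed

lemma strict_seminorm_nonneg:
  assumes a: "\<And>n. 0 \<le> a n" "a \<longlonglongrightarrow> 0"
  shows "0 \<le> strict_seminorm K a f"
\<comment> \<open>The pointwise criterion is available only for nonnegative bounds. A negative value
  would be at most 0, so all terms would vanish and the supremum would be 0.\<close>
proof (rule ccontr)
  assume *: "\<not> 0 \<le> strict_seminorm K a f"
  then have le: "\<forall>n. \<forall>x\<in>K n. a n * \<bar>apply_bcontfun f x\<bar> \<le> 0"
    unfolding strict_seminorm_le_iff[OF a order_refl, symmetric] by simp
  then have "a n * Sup (insert 0 ((\<lambda>x. \<bar>apply_bcontfun f x\<bar>) ` K n)) = 0" for n
  proof (cases "a n = 0")
    case False
    then have "\<forall>x\<in>K n. \<bar>apply_bcontfun f x\<bar> = 0"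
      using le a(1)[of n] by (metis abs_ge_zero mult_nonneg_nonneg mult_eq_0_iff order_antisym)
    then have eq: "insert 0 ((\<lambda>x. \<bar>apply_bcontfun f x\<bar>) ` K n) = {0}" by auto
    show ?thesis unfolding eq by simp
  qed simp
  then have "strict_seminorm K a f = 0" unfolding strict_seminorm_def by (simp only: cSUP_const[OF UNIV_not_empty])
  then show False using * by simp
qed

lemma strict_seminorm_ge:
  assumes a: "\<And>n. 0 \<le> a n" "a \<longlonglongrightarrow> 0" and x: "x \<in> K n"
  shows "a n * \<bar>apply_bcontfun f x\<bar> \<le> strict_seminorm K a f"
  using strict_seminorm_le_iff[OF a strict_seminorm_nonneg[OF a, of K f], of K f] x by blast

lemma seminorm_strict_seminorm:
  assumes a: "\<And>n. 0 \<le> a n" "a \<longlonglongrightarrow> 0"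
  shows "seminorm (strict_seminorm K a)"
proof -
  let ?p = "strict_seminorm K a"
  note nn = strict_seminorm_nonneg[OF a, of K] and ge = strict_seminorm_ge[OF a, of _ K]
  have tri: "?p (f + g) \<le> ?p f + ?p g" for f g
  proof (subst strict_seminorm_le_iff[OF a])
    show "\<forall>n. \<forall>x\<in>K n. a n * \<bar>apply_bcontfun (f + g) x\<bar> \<le> ?p f + ?p g"
    proof (intro allI ballI)
      fix n x assume x: "x \<in> K n"
      have "a n * \<bar>apply_bcontfun (f + g) x\<bar> \<le> a n * (\<bar>apply_bcontfun f x\<bar> + \<bar>apply_bcontfun g x\<bar>)"
        using a(1) by (intro mult_left_mono) auto
      then show "a n * \<bar>apply_bcontfun (f + g) x\<bar> \<le> ?p f + ?p g"
        using ge[OF x, of f] ge[OF x, of g] by (simp add: distrib_left)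
    qed
  qed (use nn in simp)
  have sc: "?p (c *\<^sub>R f) \<le> \<bar>c\<bar> * ?p f" for c f
  proof (subst strict_seminorm_le_iff[OF a])
    show "\<forall>n. \<forall>x\<in>K n. a n * \<bar>apply_bcontfun (c *\<^sub>R f) x\<bar> \<le> \<bar>c\<bar> * ?p f"
    proof (intro allI ballI)
      fix n x assume x: "x \<in> K n"
      show "a n * \<bar>apply_bcontfun (c *\<^sub>R f) x\<bar> \<le> \<bar>c\<bar> * ?p f"
        using mult_left_mono[OF ge[OF x, of f], of "\<bar>c\<bar>"] by (simp add: abs_mult mult_ac)
    qed
  qed (use nn in simp)
  have "?p (c *\<^sub>R f) = \<bar>c\<bar> * ?p f" for c f
  proof (cases "c = 0")
    case True
    then show ?thesis using sc[of 0 f] nn[of "0 *\<^sub>R f"] by simp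
  next
    case False
    \<comment> \<open>The reverse inequality is \<open>sc\<close> applied to the inverse
      scalar.\<close>
    then have "\<bar>c\<bar> * ?p f \<le> ?p (c *\<^sub>R f)"
      using mult_left_mono[OF sc[of "1 / c" "c *\<^sub>R f"], of "\<bar>c\<bar>"] by (simp add: abs_mult[symmetric])
    then show ?thesis using sc[of c f] by simp
  qed
  then show ?thesis using nn tri by (simp add: seminorm_def)
qed

lemma strict_seminormsI:
  "(\<And>n. compact (K n)) \<Longrightarrow> (\<And>n. 0 \<le> a n) \<Longrightarrow> a \<longlonglongrightarrow> 0 \<Longrightarrow> strict_seminorm K a \<in> strict_seminorms"
  by (auto simp: strict_seminorms_def)

lemma strict_seminormsE:
  assumes "p \<in> strict_seminorms"
  obtains K a where "p = strict_seminorm K a" "\<And>n. compact (K n)" "\<And>n. 0 \<le> a n" "a \<longlonglongrightarrow> 0"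
  using assms by (auto simp: strict_seminorms_def)

lemma directed_strict_seminorms: "directed_seminorms strict_seminorms"
  unfolding directed_seminorms_def
proof (intro conjI ballI)
  have "strict_seminorm (\<lambda>_. {}) (\<lambda>_. 0) \<in> strict_seminorms" by (rule strict_seminormsI) auto
  then show "strict_seminorms \<noteq> {}" by blast
next
  fix p :: "('a \<Rightarrow>\<^sub>C real) \<Rightarrow> real" assume "p \<in> strict_seminorms"
  then show "seminorm p" by (metis strict_seminormsE seminorm_strict_seminorm)
next
  fix p q :: "('a \<Rightarrow>\<^sub>C real) \<Rightarrow> real" assume "p \<in> strict_seminorms" "q \<in> strict_seminorms"
  then obtain K a L b where p: "p = strict_seminorm K a" "\<And>n. compact (K n)" "\<And>n. 0 \<le> a n" "a \<longlonglongrightarrow> 0"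
    and q: "q = strict_seminorm L b" "\<And>n. compact (L n)" "\<And>n. 0 \<le> b n" "b \<longlonglongrightarrow> 0"
    by (metis strict_seminormsE)
  \<comment> \<open>Unions of two compact sets are compact and the maximum of two null sequences is
    null, so this pair gives a common majorant.\<close>
  let ?c = "\<lambda>n. max (a n) (b n)" and ?M = "\<lambda>n. K n \<union> L n"
  have c: "\<And>n. 0 \<le> ?c n" "?c \<longlonglongrightarrow> 0"
    using p(3) tendsto_max[OF p(4) q(4)] by (auto simp: le_max_iff_disj)
  note ge = strict_seminorm_ge[OF c, of _ ?M] and nn = strict_seminorm_nonneg[OF c, of ?M]
  have "p f \<le> strict_seminorm ?M ?c f" for f
    unfolding p(1) strict_seminorm_le_iff[OF p(3,4) nn]
  proof (intro allI ballI)
    fix n x assume "x \<in> K n"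
    then have "?c n * \<bar>apply_bcontfun f x\<bar> \<le> strict_seminorm ?M ?c f" by (intro ge) simp
    moreover have "a n * \<bar>apply_bcontfun f x\<bar> \<le> ?c n * \<bar>apply_bcontfun f x\<bar>"
      by (intro mult_right_mono) auto
    ultimately show "a n * \<bar>apply_bcontfun f x\<bar> \<le> strict_seminorm ?M ?c f" by linarith
  qed
  moreover have "q f \<le> strict_seminorm ?M ?c f" for f
    unfolding q(1) strict_seminorm_le_iff[OF q(3,4) nn]
  proof (intro allI ballI)
    fix n x assume "x \<in> L n"
    then have "?c n * \<bar>apply_bcontfun f x\<bar> \<le> strict_seminorm ?M ?c f" by (intro ge) simp
    moreover have "b n * \<bar>apply_bcontfun f x\<bar> \<le> ?c n * \<bar>apply_bcontfun f x\<bar>"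
      by (intro mult_right_mono) auto
    ultimately show "b n * \<bar>apply_bcontfun f x\<bar> \<le> strict_seminorm ?M ?c f" by linarith
  qed
  moreover have "strict_seminorm ?M ?c \<in> strict_seminorms"
    using p q c by (intro strict_seminormsI) auto
  ultimately show "\<exists>r\<in>strict_seminorms. \<forall>f. p f \<le> r f \<and> q f \<le> r f" by blast
qed

lemma seminorm_strict: "p \<in> strict_seminorms \<Longrightarrow> seminorm p"
  by (rule directed_seminormsD[OF directed_strict_seminorms])

lemma strict_seminorms_le_norm:
  assumes "p \<in> strict_seminorms"
  obtains A where "0 < A" "\<And>f. p f \<le> A * norm f"
proof -
  obtain K a where p: "p = strict_seminorm K a" "\<And>n. 0 \<le> a n" "a \<longlonglongrightarrow> 0"
    using assms by (metis strict_seminormsE)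
  have "Bseq a" using p(3) by (rule convergent_imp_Bseq[OF convergentI])
  then obtain A where A: "0 < A" "\<And>n. a n \<le> A"
    unfolding Bseq_def by (metis abs_le_D1 real_norm_def)
  have "p f \<le> A * norm f" for f
    unfolding p(1)
    by (subst strict_seminorm_le_iff[OF p(2,3)])
      (use A p(2) in \<open>auto intro!: mult_mono abs_bcontfun_le_norm simp: less_imp_le\<close>)
  then show ?thesis using that A by blast
qed

subsection \<open>Tightness and countable convexity\<close>

text \<open>For functionals given by measures this is uniform smallness of the total variation off a
  compact set. The absolute value lets the same notion apply to sets of functionals and to a single
  seminorm.\<close>

definition uniformly_tight :: "(('a::topological_space \<Rightarrow>\<^sub>C real) \<Rightarrow> real) set \<Rightarrow> bool" where
  "uniformly_tight H \<longleftrightarrow>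
     (\<forall>e>0. \<exists>K. compact K \<and>
       (\<forall>\<phi>\<in>H. \<forall>f. norm f \<le> 1 \<and> (\<forall>x\<in>K. apply_bcontfun f x = 0) \<longrightarrow> \<bar>\<phi> f\<bar> \<le> e))"

lemma uniformly_tight_dominated:
  assumes p: "p \<in> strict_seminorms" and C: "0 < C"
    and le: "\<And>\<phi> f. \<phi> \<in> H \<Longrightarrow> \<bar>\<phi> f\<bar> \<le> C * p f"
  shows "uniformly_tight H"
  unfolding uniformly_tight_def
proof (intro allI impI)
  fix e :: real assume e: "0 < e"
  obtain K a where p: "p = strict_seminorm K a" "\<And>n. compact (K n)" "\<And>n. 0 \<le> a n" "a \<longlonglongrightarrow> 0"
    using p by (metis strict_seminormsE)
  have "0 < e / C" using e C by simp
  \<comment> \<open>From index \<open>N\<close> on the weights alone make the terms small for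
    functions of norm at most 1; the finitely many earlier sets are united into the required compact
    set.\<close>
  then obtain N where N: "\<And>n. n \<ge> N \<Longrightarrow> a n < e / C"
    using p(3,4) by (fastforce simp: LIMSEQ_iff)
  have "\<bar>\<phi> f\<bar> \<le> e" if "\<phi> \<in> H" and f: "norm f \<le> 1" "\<forall>x\<in>(\<Union>n<N. K n). apply_bcontfun f x = 0" for \<phi> f
  proof -
    have "p f \<le> e / C"
      unfolding p(1) strict_seminorm_le_iff[OF p(3,4) less_imp_le[OF \<open>0 < e / C\<close>]]
    proof (intro allI ballI)
      fix n x assume x: "x \<in> K n"
      show "a n * \<bar>apply_bcontfun f x\<bar> \<le> e / C"
      proof (cases "n < N")
        case True
        then have "apply_bcontfun f x = 0" using f(2) x by blast
        then show ?thesis using e C by simp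
      next
        case False
        have "\<bar>apply_bcontfun f x\<bar> \<le> 1" using abs_bcontfun_le_norm[of f x] f(1) by linarith
        then have "a n * \<bar>apply_bcontfun f x\<bar> \<le> a n * 1" using p(3) by (intro mult_left_mono)
        then show ?thesis using N[of n] False by simp
      qed
    qed
    then show ?thesis using le[OF that(1), of f] C by (simp add: field_simps)
  qed
  moreover have "compact (\<Union>n<N. K n)" using p(2) by (intro compact_UN) auto
  ultimately show "\<exists>K. compact K \<and>
      (\<forall>\<phi>\<in>H. \<forall>f. norm f \<le> 1 \<and> (\<forall>x\<in>K. apply_bcontfun f x = 0) \<longrightarrow> \<bar>\<phi> f\<bar> \<le> e)" by blast
qed

section \<open>Truncation, and tightness as a criterion for strict continuity\<close>

lemma apply_Bcontfun:
  fixes f :: "'a::topological_space \<Rightarrow> real"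
  assumes "continuous_on UNIV f" "\<And>x. \<bar>f x\<bar> \<le> b"
  shows "apply_bcontfun (Bcontfun f) = f"
  by (rule Bcontfun_inverse, rule bcontfun_normI[where b = b]) (use assms in auto)

definition bcf_trunc :: "real \<Rightarrow> ('a::topological_space \<Rightarrow>\<^sub>C real) \<Rightarrow> ('a \<Rightarrow>\<^sub>C real)" where
  "bcf_trunc c f = Bcontfun (\<lambda>x. max (- c) (min c (apply_bcontfun f x)))"

lemma apply_bcf_trunc: "apply_bcontfun (bcf_trunc c f) x = max (- c) (min c (apply_bcontfun f x))"
proof -
  have "apply_bcontfun (bcf_trunc c f) = (\<lambda>x. max (- c) (min c (apply_bcontfun f x)))"
    unfolding bcf_trunc_def
    by (rule apply_Bcontfun[where b = "\<bar>c\<bar>"]) (auto intro!: continuous_intros)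
  then show ?thesis by simp
qed

lemma norm_bcf_trunc_le: "0 \<le> c \<Longrightarrow> norm (bcf_trunc c f) \<le> c"
  by (rule norm_bound) (auto simp: apply_bcf_trunc)

text \<open>If \<open>f\<close> has height at most \<open>2 ^ n * c\<close> on \<open>K n\<close>,
  the slice of \<open>f\<close> between the heights \<open>2 ^ n * c\<close> and
  \<open>2 ^ (n+1) * c\<close> vanishes there, and \<open>p\<close> is tiny on it. The slices sum to
  at most \<open>2 * c\<close> and the bottom part gives \<open>C * c\<close>; this is the origin of
  the factor \<open>C + 2\<close>.\<close>

lemma tight_seminorm_dominated:
  fixes p :: "('a::topological_space \<Rightarrow>\<^sub>C real) \<Rightarrow> real"
  assumes p: "seminorm p" and C: "0 \<le> C" "\<And>f. p f \<le> C * norm f" and tight: "uniformly_tight {p}"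
  obtains q where "q \<in> strict_seminorms" "\<And>f. p f \<le> q f"
proof -
  \<comment> \<open>The rate \<open>(1/4) ^ n\<close> beats the slice height \<open>2 ^ n\<close>
    and leaves the summable factor \<open>(1/2) ^ n\<close>.\<close>
  have "\<exists>K. compact K \<and> (\<forall>f. norm f \<le> 1 \<and> (\<forall>x\<in>K. apply_bcontfun f x = 0) \<longrightarrow> p f \<le> (1/4) ^ n)" for n :: nat
  proof -
    have "(0::real) < (1/4) ^ n" by simp
    then show ?thesis
      using tight unfolding uniformly_tight_def by (metis singletonI abs_le_D1)
  qed
  then obtain K where K: "\<And>n. compact (K n)"
    "\<And>n f. norm f \<le> 1 \<Longrightarrow> \<forall>x\<in>K n. apply_bcontfun f x = 0 \<Longrightarrow> p f \<le> (1/4) ^ n" by metis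
  have key: "p f \<le> (C + 2) * c" if c: "0 < c" and f: "\<And>n x. x \<in> K n \<Longrightarrow> (1/2) ^ n * \<bar>apply_bcontfun f x\<bar> \<le> c" for f c
  proof -
    define T where "T n = bcf_trunc (2 ^ n * c) f" for n
    \<comment> \<open>Since \<open>f\<close> is bounded, truncation at height
      \<open>2 ^ N * c\<close> changes nothing, so the decomposition is a finite telescoping
      sum.\<close>
    obtain N where "norm f / c < 2 ^ N" using real_arch_pow[of 2 "norm f / c"] by auto
    then have N: "norm f \<le> 2 ^ N * c" using c by (simp add: field_simps)
    have "T N = f"
    proof (rule bcontfun_eqI)
      fix x show "apply_bcontfun (T N) x = apply_bcontfun f x"
        using abs_bcontfun_le_norm[of f x] N unfolding T_def apply_bcf_trunc by linarith
    qed
    then have f_eq: "f = T 0 + (\<Sum>n<N. T (Suc n) - T n)"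
      by (simp add: sum_lessThan_telescope)
    have diff: "p (T (Suc n) - T n) \<le> c * (1/2) ^ n" for n
    proof -
      define g where "g = (1 / (2 ^ n * c)) *\<^sub>R (T (Suc n) - T n)"
      have pos: "0 < 2 ^ n * c" using c by simp
      have T_eq: "T (Suc n) - T n = (2 ^ n * c) *\<^sub>R g" using c by (simp add: g_def)
      have bd: "\<bar>apply_bcontfun (T (Suc n) - T n) x\<bar> \<le> 2 ^ n * c" for x
        using pos by (auto simp: T_def apply_bcf_trunc)
      have "norm g \<le> 1"
      proof (rule norm_bound)
        fix x show "norm (apply_bcontfun g x) \<le> 1"
        proof -
          have "norm (apply_bcontfun g x) = \<bar>apply_bcontfun (T (Suc n) - T n) x\<bar> / (2 ^ n * c)"
            using c by (simp add: g_def abs_mult)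
          then show ?thesis using bd[of x] pos by (simp only: divide_le_eq_1_pos)
        qed
      qed
      moreover have "apply_bcontfun g x = 0" if "x \<in> K n" for x
      proof -
        have "\<bar>apply_bcontfun f x\<bar> \<le> 2 ^ n * c" using f[OF that] by (simp add: field_simps)
        then show ?thesis using pos by (auto simp: g_def T_def apply_bcf_trunc max_def min_def)
      qed
      ultimately have "p g \<le> (1/4) ^ n" using K(2) by blast
      then have "p (T (Suc n) - T n) \<le> (2 ^ n * c) * (1/4) ^ n"
        unfolding T_eq seminorm_scaleR[OF p] abs_of_pos[OF pos] using pos by (intro mult_left_mono) auto
      also have "\<dots> = c * (1/2) ^ n"
        by (simp add: power_divide field_simps flip: power_mult_distrib)
      finally show ?thesis .
    qed
    have "p f \<le> p (T 0) + (\<Sum>n<N. p (T (Suc n) - T n))"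
    proof -
      have "p f \<le> p (T 0) + p (\<Sum>n<N. T (Suc n) - T n)"
        by (subst f_eq) (rule seminorm_triangle[OF p])
      then show ?thesis using seminorm_sum_le[OF p, of "\<lambda>n. T (Suc n) - T n" "{..<N}"] by linarith
    qed
    also have "(\<Sum>n<N. p (T (Suc n) - T n)) \<le> (\<Sum>n<N. c * (1/2) ^ n)" by (intro sum_mono diff)
    also have "\<dots> = c * (\<Sum>n<N. (1/2) ^ n)" by (simp add: sum_distrib_left)
    also have "\<dots> \<le> c * 2"
    proof -
      have "(\<Sum>n<N. (1/2 :: real) ^ n) \<le> (\<Sum>n. (1/2) ^ n)" by (rule sum_le_suminf) auto
      then show ?thesis using c by (intro mult_left_mono) (auto simp: suminf_geometric)
    qed
    also have "p (T 0) \<le> C * c"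
    proof -
      have "norm (T 0) \<le> c" using norm_bcf_trunc_le[of c f] c by (simp add: T_def)
      then show ?thesis using C(2)[of "T 0"] C(1) by (meson mult_left_mono order_trans)
    qed
    finally show ?thesis by (simp add: algebra_simps)
  qed
  define a :: "nat \<Rightarrow> real" where "a n = (C + 2) * (1/2) ^ n" for n
  have "a \<longlonglongrightarrow> (C + 2) * 0" unfolding a_def
    by (intro tendsto_mult tendsto_const LIMSEQ_power_zero) auto
  then have a: "\<And>n. 0 \<le> a n" "a \<longlonglongrightarrow> 0" using C by (auto simp: a_def)
  \<comment> \<open>The estimate \<open>key\<close> requires a positive bound, while the strict
    seminorm of \<open>f\<close> may be 0; hence the added \<open>e\<close>.\<close>
  have "p f \<le> strict_seminorm K a f" for f
  proof (rule field_le_epsilon)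
    fix e :: real assume e: "0 < e"
    let ?s = "strict_seminorm K a f"
    have nn: "0 \<le> ?s" by (rule strict_seminorm_nonneg[OF a])
    have "p f \<le> (C + 2) * ((?s + e) / (C + 2))"
    proof (rule key)
      show "0 < (?s + e) / (C + 2)" using nn e C by simp
      fix n x assume "x \<in> K n"
      then have "a n * \<bar>apply_bcontfun f x\<bar> \<le> ?s + e" using strict_seminorm_ge[OF a, of x K n f] e by simp
      then show "(1/2) ^ n * \<bar>apply_bcontfun f x\<bar> \<le> (?s + e) / (C + 2)"
        using C by (simp add: a_def field_simps)
    qed
    then show "p f \<le> ?s + e" using C by simp
  qed
  then show ?thesis by (intro that[OF strict_seminormsI[OF K(1) a]])
qed

lemma continuous_seminorm_tight:
  assumes "seminorm p" "continuous_map strict_topology euclideanreal p"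
  shows "uniformly_tight {p}"
proof -
  obtain q C where "q \<in> strict_seminorms" "0 < C" "\<And>f. p f \<le> C * q f"
    using continuous_seminorm_dominated[OF directed_strict_seminorms assms(1)] assms(2)
    unfolding strict_topology_eq by metis
  then show ?thesis
    using seminorm_nonneg[OF assms(1)] by (intro uniformly_tight_dominated) auto
qed

text \<open>With \<open>continuous_seminorm_tight\<close>, continuity of a norm-bounded seminorm
  amounts to tightness, a condition that can be checked termwise in a series.\<close>

lemma tight_seminorm_continuous:
  assumes "seminorm p" "0 \<le> C" "\<And>f. p f \<le> C * norm f" "uniformly_tight {p}"
  shows "continuous_map strict_topology euclideanreal p"
proof -
  obtain q where "q \<in> strict_seminorms" "\<And>f. p f \<le> q f"
    using tight_seminorm_dominated[OF assms] by metis
  then show ?thesis unfolding strict_topology_eq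
    by (intro continuous_map_seminorm[OF directed_strict_seminorms assms(1)])
qed

text \<open>Domination by the norm bounds a tail of the series by its total weight, uniformly on the
  unit ball. Only finitely many seminorms are left, and the union of their compact sets is
  compact.\<close>

lemma countably_convex_strict:
  "countably_convex (dominated_seminorms (strict_topology :: ('a::topological_space \<Rightarrow>\<^sub>C real) topology))"
  unfolding countably_convex_def
proof (intro allI impI)
  fix p :: "nat \<Rightarrow> ('a \<Rightarrow>\<^sub>C real) \<Rightarrow> real" and \<alpha> :: "nat \<Rightarrow> real"
  assume *: "(\<forall>n. p n \<in> dominated_seminorms strict_topology) \<and> (\<forall>n. 0 \<le> \<alpha> n) \<and> \<alpha> sums 1"
  then have sn: "\<And>n. seminorm (p n)" and le: "\<And>n f. p n f \<le> norm f"
    and cont: "\<And>n. continuous_map strict_topology euclideanreal (p n)"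
    and \<alpha>: "\<And>n. 0 \<le> \<alpha> n" "\<alpha> sums 1"
    by (auto simp: dominated_seminorms_def)
  note nn = seminorm_nonneg[OF sn]
  define P where "P f = (\<Sum>n. \<alpha> n * p n f)" for f
  have sum\<alpha>: "summable \<alpha>" "suminf \<alpha> = 1" using \<alpha>(2) by (auto simp: sums_iff)
  have le\<alpha>: "\<alpha> n * p n f \<le> \<alpha> n * norm f" for n f using le \<alpha> by (intro mult_left_mono)
  have summ: "summable (\<lambda>n. \<alpha> n * p n f)" for f
    by (rule summable_comparison_test'[where g = "\<lambda>n. \<alpha> n * norm f" and N = 0])
      (use le\<alpha> sum\<alpha> \<alpha> nn in \<open>auto intro: summable_mult2 simp: abs_mult\<close>)
  have Ple: "P f \<le> norm f" for f
  proof -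
    have "P f \<le> (\<Sum>n. \<alpha> n * norm f)" unfolding P_def
      by (intro suminf_le le\<alpha> summ summable_mult2 sum\<alpha>)
    also have "\<dots> = norm f" using suminf_mult2[OF sum\<alpha>(1), of "norm f"] sum\<alpha>(2) by simp
    finally show ?thesis .
  qed
  have snP: "seminorm P"
    unfolding seminorm_def
  proof (intro conjI allI)
    fix f show "0 \<le> P f" unfolding P_def by (intro suminf_nonneg summ) (use \<alpha> nn in auto)
  next
    fix f g
    have "P (f + g) \<le> (\<Sum>n. \<alpha> n * p n f + \<alpha> n * p n g)" unfolding P_def
      by (intro suminf_le summ summable_add)
        (auto simp flip: distrib_left intro!: mult_left_mono \<alpha> seminorm_triangle[OF sn])
    also have "\<dots> = P f + P g" unfolding P_def by (intro suminf_add[symmetric] summ)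
    finally show "P (f + g) \<le> P f + P g" .
  next
    fix c f
    have "P (c *\<^sub>R f) = (\<Sum>n. \<bar>c\<bar> * (\<alpha> n * p n f))"
      unfolding P_def by (simp add: seminorm_scaleR[OF sn] mult_ac)
    also have "\<dots> = \<bar>c\<bar> * P f" unfolding P_def by (intro suminf_mult summ)
    finally show "P (c *\<^sub>R f) = \<bar>c\<bar> * P f" .
  qed
  have "uniformly_tight {P}"
    unfolding uniformly_tight_def
  proof (intro allI impI)
    fix e :: real assume e: "0 < e"
    then have e2: "0 < e / 2" by simp
    have "\<exists>K. compact K \<and> (\<forall>f. norm f \<le> 1 \<and> (\<forall>x\<in>K. apply_bcontfun f x = 0) \<longrightarrow> p n f \<le> e / 2)" for n
      using continuous_seminorm_tight[OF sn cont, of n] e2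
      unfolding uniformly_tight_def by (metis singletonI abs_le_D1)
    then obtain K where K: "\<And>n. compact (K n)"
      "\<And>n f. norm f \<le> 1 \<Longrightarrow> \<forall>x\<in>K n. apply_bcontfun f x = 0 \<Longrightarrow> p n f \<le> e / 2" by metis
    \<comment> \<open>The weight beyond \<open>N\<close> is below \<open>e / 2\<close>; the first
      \<open>N\<close> seminorms contribute at most \<open>e / 2\<close>, as their weights add up to
      at most 1.\<close>
    obtain N where N: "1 - e / 2 < sum \<alpha> {..<N}"
    proof -
      have "(\<lambda>N. sum \<alpha> {..<N}) \<longlonglongrightarrow> 1" using \<alpha>(2) by (simp add: sums_def)
      then have "eventually (\<lambda>N. 1 - e / 2 < sum \<alpha> {..<N}) sequentially"
        by (rule order_tendstoD) (use e in simp)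
      then show ?thesis using that by (auto simp: eventually_sequentially)
    qed
    have "P f \<le> e" if f: "norm f \<le> 1" "\<forall>x\<in>(\<Union>n<N. K n). apply_bcontfun f x = 0" for f
    proof -
      have "P f = (\<Sum>n. \<alpha> (n + N) * p (n + N) f) + (\<Sum>n<N. \<alpha> n * p n f)"
        unfolding P_def by (rule suminf_split_initial_segment[OF summ])
      also have "(\<Sum>n<N. \<alpha> n * p n f) \<le> (\<Sum>n<N. \<alpha> n * (e / 2))"
      proof (intro sum_mono mult_left_mono \<alpha>)
        fix n assume "n \<in> {..<N}"
        then show "p n f \<le> e / 2" by (intro K(2) f) (use f in blast)
      qed
      also have "\<dots> = sum \<alpha> {..<N} * (e / 2)" by (simp only: sum_distrib_right)
      also have "\<dots> \<le> 1 * (e / 2)"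
        using sum_le_suminf[OF sum\<alpha>(1), of "{..<N}"] \<alpha> sum\<alpha>(2) e by (intro mult_right_mono) auto
      also have "(\<Sum>n. \<alpha> (n + N) * p (n + N) f) \<le> (\<Sum>n. \<alpha> (n + N))"
      proof (rule suminf_le)
        show "summable (\<lambda>n. \<alpha> (n + N) * p (n + N) f)" "summable (\<lambda>n. \<alpha> (n + N))"
          using summ[of f] sum\<alpha>(1) by (auto intro: summable_ignore_initial_segment[where f = "\<lambda>n. \<alpha> n * p n f"]
              summable_ignore_initial_segment)
        fix n
        have "\<alpha> (n + N) * p (n + N) f \<le> \<alpha> (n + N) * 1"
          using le[of "n + N" f] f(1) \<alpha> by (intro mult_left_mono) auto
        then show "\<alpha> (n + N) * p (n + N) f \<le> \<alpha> (n + N)" by simp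
      qed
      also have "(\<Sum>n. \<alpha> (n + N)) = 1 - sum \<alpha> {..<N}"
        using suminf_minus_initial_segment[OF sum\<alpha>(1), of N] sum\<alpha>(2) by simp
      finally show ?thesis using N by linarith
    qed
    moreover have "compact (\<Union>n<N. K n)" using K(1) by (intro compact_UN) auto
    ultimately show "\<exists>K. compact K \<and>
        (\<forall>\<phi>\<in>{P}. \<forall>f. norm f \<le> 1 \<and> (\<forall>x\<in>K. apply_bcontfun f x = 0) \<longrightarrow> \<bar>\<phi> f\<bar> \<le> e)"
      using seminorm_nonneg[OF snP] by (intro exI[of _ "\<Union>n<N. K n"]) auto
  qed
  then have "continuous_map strict_topology euclideanreal P"
    by (intro tight_seminorm_continuous[OF snP, of 1]) (use Ple in auto)
  then show "(\<lambda>x. \<Sum>n. \<alpha> n * p n x) \<in> dominated_seminorms strict_topology"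
    using snP Ple unfolding P_def by (simp add: dominated_seminorms_def)
qed

subsection \<open>Bounded sets and sequential completeness\<close>

lemma open_strict_topology:
  assumes "openin strict_topology U"
  shows "open U"
proof (rule openI)
  fix f assume "f \<in> U"
  then obtain p r where p: "p \<in> strict_seminorms" "0 < r" "{g. p (g - f) < r} \<subseteq> U"
    using assms unfolding strict_topology_eq openin_seminorm_topology[OF directed_strict_seminorms] by blast
  obtain A where A: "0 < A" "\<And>f. p f \<le> A * norm f" using strict_seminorms_le_norm[OF p(1)] by metis
  have "ball f (r / A) \<subseteq> U"
  proof
    fix g assume "g \<in> ball f (r / A)"
    then have "A * norm (g - f) < r" using A(1) by (simp add: dist_norm norm_minus_commute field_simps)
    then show "g \<in> U" using A(2)[of "g - f"] p(3) by force
  qed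
  then show "\<exists>e>0. ball f e \<subseteq> U" using p(2) A(1) by (intro exI[of _ "r / A"]) simp
qed

text \<open>The singletons \<open>{x n}\<close> are compact, so point values can be tested with any
  null weights. Values beyond the square of \<open>Suc n\<close> still exceed \<open>Suc n\<close>
  after multiplication by the weight \<open>1 / Suc n\<close>.\<close>

lemma unbounded_not_strictly_bounded:
  fixes B :: "('a::topological_space \<Rightarrow>\<^sub>C real) set"
  assumes "\<not> bounded B"
  obtains p where "p \<in> strict_seminorms" "\<And>s. \<exists>f\<in>B. s < p f"
proof -
  have "\<exists>f x. f \<in> B \<and> real (Suc n) ^ 2 < \<bar>apply_bcontfun f x\<bar>" for n
  proof (rule ccontr)
    assume "\<not> ?thesis"
    then have "norm f \<le> real (Suc n) ^ 2" if "f \<in> B" for f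
      using that by (intro norm_bound) (auto simp: not_less)
    then show False using assms by (auto simp: bounded_iff)
  qed
  then obtain f x where f: "\<And>n. f n \<in> B" and x: "\<And>n. real (Suc n) ^ 2 < \<bar>apply_bcontfun (f n) (x n)\<bar>"
    by metis
  define p where "p = strict_seminorm (\<lambda>n. {x n}) (\<lambda>n. 1 / real (Suc n))"
  have a: "\<And>n. 0 \<le> 1 / real (Suc n)" "(\<lambda>n. 1 / real (Suc n)) \<longlonglongrightarrow> 0"
    using LIMSEQ_inverse_real_of_nat by (auto simp: inverse_eq_divide)
  have "real (Suc n) < p (f n)" for n
  proof -
    have "real (Suc n) < 1 / real (Suc n) * \<bar>apply_bcontfun (f n) (x n)\<bar>"
      using x[of n] by (simp add: field_simps power2_eq_square)
    also have "\<dots> \<le> p (f n)" unfolding p_def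
      by (rule strict_seminorm_ge[OF a, of "x n" "\<lambda>n. {x n}"]) simp
    finally show ?thesis .
  qed
  moreover have "\<exists>n. s < real (Suc n)" for s
    using reals_Archimedean2[of s] by (metis less_trans lessI of_nat_less_iff)
  ultimately have "\<exists>g\<in>B. s < p g" for s using f by (meson less_trans)
  moreover have "p \<in> strict_seminorms" unfolding p_def using a by (intro strict_seminormsI) auto
  ultimately show ?thesis using that by blast
qed

lemma tvs_bounded_strict_iff: "tvs_bounded strict_topology B \<longleftrightarrow> bounded B"
proof
  assume B: "tvs_bounded strict_topology B"
  show "bounded B"
  proof (rule ccontr)
    assume "\<not> bounded B"
    then obtain p where p: "p \<in> strict_seminorms" "\<And>s. \<exists>f\<in>B. s < p f"
      using unbounded_not_strictly_bounded by metis
    have "openin strict_topology {f. p f < 1}"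
      using openin_seminorm_topology_ball[OF p(1), of 1 0] by (simp add: strict_topology_eq)
    moreover have "0 \<in> {f. p f < 1}" using seminorm_zero[OF seminorm_strict[OF p(1)]] by simp
    ultimately obtain s where s: "0 < s" "\<And>t. s < t \<Longrightarrow> B \<subseteq> (\<lambda>x. t *\<^sub>R x) ` {f. p f < 1}"
      using B unfolding tvs_bounded_def by blast
    obtain f where f: "f \<in> B" "s + 1 < p f" using p(2) by blast
    then obtain g where "f = (s + 1) *\<^sub>R g" "p g < 1" using s(2)[of "s + 1"] by auto
    then show False
      using f(2) s(1) seminorm_scaleR[OF seminorm_strict[OF p(1)], of "s + 1" g] by simp
  qed
next
  assume "bounded B"
  then obtain M where M: "0 < M" "\<And>f. f \<in> B \<Longrightarrow> norm f \<le> M" by (auto simp: bounded_pos)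
  show "tvs_bounded strict_topology B"
    unfolding tvs_bounded_def
  proof (intro allI impI, elim conjE)
    fix U :: "('a \<Rightarrow>\<^sub>C real) set" assume "openin strict_topology U" "0 \<in> U"
    then obtain p r where p: "p \<in> strict_seminorms" "0 < r" "{f. p f < r} \<subseteq> U"
      using openin_seminorm_topology_0[OF directed_strict_seminorms] by (metis strict_topology_eq)
    obtain A where A: "0 < A" "\<And>f. p f \<le> A * norm f" using strict_seminorms_le_norm[OF p(1)] by metis
    \<comment> \<open>On \<open>B\<close> the seminorm is at most \<open>A * M\<close>, so beyond
      this threshold division by \<open>t\<close> brings it below \<open>r\<close>.\<close>
    have "B \<subseteq> (\<lambda>x. t *\<^sub>R x) ` U" if t: "A * M / r < t" for t
    proof
      fix f assume f: "f \<in> B"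
      have "0 < A * M / r" using A M p by simp
      then have t0: "0 < t" using t by linarith
      have "p f \<le> A * M" using A(2)[of f] mult_left_mono[OF M(2)[OF f] less_imp_le[OF A(1)]] by linarith
      also have "\<dots> < t * r" using t p(2) by (simp add: field_simps)
      finally have "p ((1 / t) *\<^sub>R f) < r"
        using t0 by (simp add: seminorm_scaleR[OF seminorm_strict[OF p(1)]] field_simps)
      then have "(1 / t) *\<^sub>R f \<in> U" using p(3) by blast
      moreover have "f = t *\<^sub>R ((1 / t) *\<^sub>R f)" using t0 by simp
      ultimately show "f \<in> (\<lambda>x. t *\<^sub>R x) ` U" by blast
    qed
    then show "\<exists>s>0. \<forall>t>s. B \<subseteq> (\<lambda>x. t *\<^sub>R x) ` U"
      using A M p by (intro exI[of _ "A * M / r"]) auto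
  qed
qed

section \<open>Cauchy sequences for the strict topology\<close>

lemma strict_Cauchy_seminorm:
  assumes "tvs_Cauchy strict_topology s" "p \<in> strict_seminorms" "0 < e"
  obtains N where "\<And>m n. N \<le> m \<Longrightarrow> N \<le> n \<Longrightarrow> p (s m - s n) < e"
proof -
  have "openin strict_topology {f. p f < e}"
    using openin_seminorm_topology_ball[OF assms(2,3), of 0] by (simp add: strict_topology_eq)
  moreover have "0 \<in> {f. p f < e}"
    using seminorm_zero[OF seminorm_strict[OF assms(2)]] assms(3) by simp
  ultimately obtain N where "\<forall>m\<ge>N. \<forall>n\<ge>N. s m - s n \<in> {f. p f < e}"
    using assms(1) unfolding tvs_Cauchy_def by metis
  then show ?thesis using that[of N] by simp
qed

text \<open>Every strict seminorm is bounded along a Cauchy sequence, whereas an unbounded range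
  would admit one that is not.\<close>

lemma strict_Cauchy_bounded:
  fixes s :: "nat \<Rightarrow> 'a::topological_space \<Rightarrow>\<^sub>C real"
  assumes s: "tvs_Cauchy strict_topology s"
  shows "bounded (range s)"
proof (rule ccontr)
  assume "\<not> bounded (range s)"
  then obtain p where p: "p \<in> strict_seminorms" "\<And>t. \<exists>f\<in>range s. t < p f"
    using unbounded_not_strictly_bounded by metis
  obtain N where N: "\<And>m n. N \<le> m \<Longrightarrow> N \<le> n \<Longrightarrow> p (s m - s n) < 1"
    using strict_Cauchy_seminorm[OF s p(1) zero_less_one] by metis
  define M where "M = Max ((\<lambda>n. p (s n)) ` {..N}) + 1"
  have M: "p (s n) + 1 \<le> M" if "n \<le> N" for n using that by (simp add: M_def)
  have "p (s n) \<le> M" for n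
  proof (cases "n \<le> N")
    case False
    then have "p (s n - s N) < 1" by (intro N) auto
    then show ?thesis
      using seminorm_triangle[OF seminorm_strict[OF p(1)], of "s n - s N" "s N"] M[of N] by simp
  qed (use M in force)
  then show False using p(2)[of M] by (metis imageE not_le)
qed

lemma compact_sequence_with_limit:
  fixes x :: "nat \<Rightarrow> 'a::topological_space"
  assumes "x \<longlonglongrightarrow> l"
  shows "compact (insert l (range x))"
proof (rule compactI)
  fix C assume C: "\<forall>T\<in>C. open T" "insert l (range x) \<subseteq> \<Union>C"
  then obtain T where T: "T \<in> C" "l \<in> T" by blast
  then obtain N where N: "\<And>n. n \<ge> N \<Longrightarrow> x n \<in> T"
    using topological_tendstoD[OF assms, of T] C(1) by (auto simp: eventually_sequentially)
  have "\<forall>n. \<exists>S\<in>C. x n \<in> S" using C(2) by blast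
  then obtain S where S: "\<And>n. S n \<in> C" "\<And>n. x n \<in> S n" by metis
  have "insert l (range x) \<subseteq> \<Union>(insert T (S ` {..<N}))"
  proof
    fix y assume "y \<in> insert l (range x)"
    then consider "y = l" | n where "y = x n" by blast
    then show "y \<in> \<Union>(insert T (S ` {..<N}))"
    proof cases
      case (2 n)
      then show ?thesis using N[of n] S(2)[of n] by (cases "n < N") auto
    qed (use T in simp)
  qed
  moreover have "insert T (S ` {..<N}) \<subseteq> C" "finite (insert T (S ` {..<N}))" using S T by auto
  ultimately show "\<exists>C'\<subseteq>C. finite C' \<and> insert l (range x) \<subseteq> \<Union>C'" by blast
qed

text \<open>With a constant sequence of compact sets and \<open>a 0 = 1\<close>, the term of index 0
  is already the supremum over \<open>K\<close>.\<close>

lemma sup_on_compact_strict: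
  assumes "compact K"
  obtains p where "p \<in> strict_seminorms" "\<And>f x. x \<in> K \<Longrightarrow> \<bar>apply_bcontfun f x\<bar> \<le> p f"
proof -
  define a :: "nat \<Rightarrow> real" where "a n = (1/2) ^ n" for n
  have a: "\<And>n. 0 \<le> a n" "a \<longlonglongrightarrow> 0"
    unfolding a_def by (auto intro!: LIMSEQ_power_zero)
  have "\<bar>apply_bcontfun f x\<bar> \<le> strict_seminorm (\<lambda>_. K) a f" if "x \<in> K" for f x
    using strict_seminorm_ge[OF a, of x "\<lambda>_. K" 0 f] that by (simp add: a_def)
  then show ?thesis using that strict_seminormsI[of "\<lambda>_. K" a] assms a by metis
qed

lemma sequentially_complete_strict:
  "sequentially_complete (strict_topology :: ('a::metric_space \<Rightarrow>\<^sub>C real) topology)"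
  unfolding sequentially_complete_def
proof (intro allI impI)
  fix s :: "nat \<Rightarrow> 'a \<Rightarrow>\<^sub>C real" assume s: "tvs_Cauchy strict_topology s"
  have unif: "\<exists>N. \<forall>m\<ge>N. \<forall>n\<ge>N. \<forall>x\<in>K. \<bar>apply_bcontfun (s m) x - apply_bcontfun (s n) x\<bar> < e"
    if K: "compact K" and e: "0 < e" for K e
  proof -
    obtain p where p: "p \<in> strict_seminorms" "\<And>f x. x \<in> K \<Longrightarrow> \<bar>apply_bcontfun f x\<bar> \<le> p f"
      using sup_on_compact_strict[OF K] by metis
    obtain N where N: "\<And>m n. N \<le> m \<Longrightarrow> N \<le> n \<Longrightarrow> p (s m - s n) < e"
      using strict_Cauchy_seminorm[OF s p(1) e] by metis
    have "\<bar>apply_bcontfun (s m) x - apply_bcontfun (s n) x\<bar> < e" if "N \<le> m" "N \<le> n" "x \<in> K" for m n x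
      using p(2)[OF that(3), of "s m - s n"] N[OF that(1,2)] by simp
    then show ?thesis by blast
  qed
  obtain M where M: "\<And>n. norm (s n) \<le> M"
    using strict_Cauchy_bounded[OF s] by (auto simp: bounded_iff)
  have "\<exists>l. (\<lambda>n. apply_bcontfun (s n) x) \<longlonglongrightarrow> l" for x
  proof -
    have "Cauchy (\<lambda>n. apply_bcontfun (s n) x)"
      using unif[of "{x}"] by (intro CauchyI) auto
    then show ?thesis using Cauchy_convergent_iff convergent_def by blast
  qed
  then obtain l where l: "\<And>x. (\<lambda>n. apply_bcontfun (s n) x) \<longlonglongrightarrow> l x" by metis
  have lbd: "\<bar>l x\<bar> \<le> M" for x
  proof (rule tendsto_upperbound[OF tendsto_rabs[OF l]])
    show "\<forall>\<^sub>F n in sequentially. \<bar>apply_bcontfun (s n) x\<bar> \<le> M"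
      using abs_bcontfun_le_norm[of "s _" x] M by (intro always_eventually allI) (metis order_trans)
  qed simp
  have cont_l: "continuous_on UNIV l"
  proof (rule continuous_on_sequentiallyI)
    fix u and y :: 'a assume u: "u \<longlonglongrightarrow> y"
    \<comment> \<open>In a metric space continuity can be tested along sequences, and a convergent
      sequence with its limit is compact. Uniform convergence on this set therefore
      suffices.\<close>
    define K where "K = insert y (range u)"
    have K: "compact K" unfolding K_def by (rule compact_sequence_with_limit[OF u])
    have "uniform_limit K (\<lambda>n. apply_bcontfun (s n)) l sequentially"
    proof (rule uniform_limitI)
      fix e :: real assume e: "0 < e"
      then obtain N where N: "\<And>m n x. N \<le> m \<Longrightarrow> N \<le> n \<Longrightarrow> x \<in> K \<Longrightarrow>
          \<bar>apply_bcontfun (s m) x - apply_bcontfun (s n) x\<bar> < e / 2"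
        using unif[OF K, of "e / 2"] by auto
      have "dist (apply_bcontfun (s m) x) (l x) < e" if "N \<le> m" "x \<in> K" for m x
      proof -
        have "(\<lambda>n. \<bar>apply_bcontfun (s m) x - apply_bcontfun (s n) x\<bar>) \<longlonglongrightarrow> \<bar>apply_bcontfun (s m) x - l x\<bar>"
          by (intro tendsto_intros l)
        then have "\<bar>apply_bcontfun (s m) x - l x\<bar> \<le> e / 2"
          by (rule tendsto_upperbound)
            (use N[OF that(1) _ that(2)] in \<open>auto simp: eventually_sequentially intro!: exI[of _ N] less_imp_le\<close>)
        then show ?thesis using e by (simp add: dist_real_def)
      qed
      then show "\<forall>\<^sub>F n in sequentially. \<forall>x\<in>K. dist (apply_bcontfun (s n) x) (l x) < e"
        unfolding eventually_sequentially by blast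
    qed
    then have "continuous_on K l"
      by (intro uniform_limit_theorem[of _ "\<lambda>n. apply_bcontfun (s n)"]) auto
    then show "(\<lambda>n. l (u n)) \<longlonglongrightarrow> l y"
      using u by (auto simp: continuous_on_sequentially K_def o_def)
  qed
  define L where "L = Bcontfun l"
  have L: "apply_bcontfun L = l" unfolding L_def by (rule apply_Bcontfun[OF cont_l lbd])
  have "limitin strict_topology s L sequentially"
    unfolding limitin_def
  proof (intro conjI allI impI)
    show "L \<in> topspace strict_topology"
      by (simp add: strict_topology_eq topspace_seminorm_topology[OF directed_strict_seminorms])
  next
    fix U assume "openin strict_topology U \<and> L \<in> U"
    then obtain p r where p: "p \<in> strict_seminorms" "0 < r" "{f. p (f - L) < r} \<subseteq> U"
      unfolding strict_topology_eq openin_seminorm_topology[OF directed_strict_seminorms] by blast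
    obtain K a where K: "p = strict_seminorm K a" "\<And>n. 0 \<le> a n" "a \<longlonglongrightarrow> 0"
      using strict_seminormsE[OF p(1)] by metis
    obtain N where N: "\<And>m n. N \<le> m \<Longrightarrow> N \<le> n \<Longrightarrow> p (s m - s n) < r / 2"
      using strict_Cauchy_seminorm[OF s p(1), of "r / 2"] p(2) by auto
    have "s m \<in> U" if m: "N \<le> m" for m
    proof -
      \<comment> \<open>The Cauchy estimate holds at every point with its weight, so it survives the
        limit in \<open>n\<close>. Starting from \<open>r / 2\<close> keeps the final inequality
        strict.\<close>
      have "p (s m - L) \<le> r / 2"
        unfolding K(1)
      proof (subst strict_seminorm_le_iff[OF K(2,3)], goal_cases)
        case 2
        show ?case
        proof (intro allI ballI)
          fix k x assume x: "x \<in> K k"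
          have "(\<lambda>n. a k * \<bar>apply_bcontfun (s m) x - apply_bcontfun (s n) x\<bar>) \<longlonglongrightarrow> a k * \<bar>apply_bcontfun (s m) x - l x\<bar>"
            by (intro tendsto_intros l)
          moreover have "a k * \<bar>apply_bcontfun (s m) x - apply_bcontfun (s n) x\<bar> \<le> r / 2" if "N \<le> n" for n
            using strict_seminorm_ge[OF K(2,3), of x K k, OF x, of "s m - s n"] N[OF m that] by (simp add: K(1))
          ultimately have "a k * \<bar>apply_bcontfun (s m) x - l x\<bar> \<le> r / 2"
            by (intro LIMSEQ_le_const2[where X = "\<lambda>n. a k * \<bar>apply_bcontfun (s m) x - apply_bcontfun (s n) x\<bar>"]) blast+
          then show "a k * \<bar>apply_bcontfun (s m - L) x\<bar> \<le> r / 2" by (simp add: L)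
        qed
      qed (use p(2) in simp)
      then show ?thesis using p(2,3) by auto
    qed
    then show "\<forall>\<^sub>F n in sequentially. s n \<in> U" unfolding eventually_sequentially by blast
  qed
  then show "\<exists>l. limitin strict_topology s l sequentially" ..
qed

lemma locally_convex_strict: "locally_convex_space strict_topology"
  unfolding strict_topology_eq by (rule locally_convex_seminorm_topology[OF directed_strict_seminorms])

lemma condition_C_strict: "condition_C (strict_topology :: ('a::metric_space \<Rightarrow>\<^sub>C real) topology)"
  unfolding condition_C_def
  by (intro conjI allI impI locally_convex_strict sequentially_complete_strict open_strict_topology
      tvs_bounded_strict_iff countably_convex_strict)

subsection \<open>Compact families of functionals\<close>

text \<open>Banach-Steinhaus by Baire: some level set \<open>A n\<close> contains a closed ball. The
  constant \<open>2 * n / r\<close> comes from writing a vector of length \<open>r\<close> as the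
  difference of two points of this ball.\<close>

lemma uniform_boundedness_real:
  fixes H :: "('b::{real_normed_vector,complete_space} \<Rightarrow> real) set"
  assumes lin: "\<And>\<phi>. \<phi> \<in> H \<Longrightarrow> linear \<phi>" and cont: "\<And>\<phi>. \<phi> \<in> H \<Longrightarrow> continuous_on UNIV \<phi>"
    and bdd: "\<And>x. \<exists>B. \<forall>\<phi>\<in>H. \<bar>\<phi> x\<bar> \<le> B"
  obtains C where "0 \<le> C" "\<And>\<phi> x. \<phi> \<in> H \<Longrightarrow> \<bar>\<phi> x\<bar> \<le> C * norm x"
proof -
  define A where "A n = (\<Inter>\<phi>\<in>H. {x. \<bar>\<phi> x\<bar> \<le> real n})" for n
  have cl: "closed (A n)" for n
    unfolding A_def by (intro closed_INT ballI closed_Collect_le continuous_intros cont)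
  have "x \<in> (\<Union>n. A n)" for x
  proof -
    obtain B where B: "\<forall>\<phi>\<in>H. \<bar>\<phi> x\<bar> \<le> B" using bdd by blast
    obtain n where "B \<le> real n" using real_arch_simple by blast
    then have "x \<in> A n" using B by (auto simp: A_def intro: order_trans)
    then show ?thesis by blast
  qed
  then have un: "(\<Union>n. A n) = UNIV" by blast
  obtain n where n: "interior (A n) \<noteq> {}"
  proof (rule ccontr)
    assume "\<not> thesis"
    then have "interior (A n) = {}" for n using that by blast
    then have "Met_TC.mtopology interior_of \<Union>(range A) = {}"
      by (intro Met_TC.metric_Baire_category_alt) (auto simp: cl complete_UNIV)
    then show False using un by simp
  qed
  then obtain z r where r: "0 < r" "cball z r \<subseteq> A n"
    by (metis all_not_in_conv mem_interior_cball)
  have "\<bar>\<phi> x\<bar> \<le> (2 * real n / r) * norm x" if \<phi>: "\<phi> \<in> H" for \<phi> x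
  proof (cases "x = 0")
    case False
    define y where "y = (r / norm x) *\<^sub>R x"
    have "z + y \<in> A n" "z \<in> A n" using r False by (auto simp: y_def dist_norm subset_iff)
    then have "\<bar>\<phi> (z + y)\<bar> \<le> n" "\<bar>\<phi> z\<bar> \<le> n" using \<phi> by (auto simp: A_def)
    then have "\<bar>\<phi> y\<bar> \<le> 2 * real n" using linear_add[OF lin[OF \<phi>], of z y] by linarith
    moreover have "\<phi> y = (r / norm x) * \<phi> x" using linear_scale[OF lin[OF \<phi>]] by (simp add: y_def)
    ultimately show ?thesis using r False by (simp add: abs_mult field_simps)
  qed (simp add: linear_0[OF lin[OF \<phi>]])
  then show ?thesis using that[of "2 * real n / r"] r(1) by simp
qed

section \<open>Cluster points, and a Phillips lemma for additive set functions\<close>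

text \<open>If no cluster point existed, every point of \<open>H\<close> would have a basic
  neighbourhood that the sequence eventually leaves; a finite subcover then leaves no room for late
  terms. Basic neighbourhoods see finitely many coordinates, hence the finite set
  \<open>S\<close>.\<close>

lemma compactin_pointwise_cluster:
  fixes H :: "('b \<Rightarrow> real) set"
  assumes H: "compactin (powertop_real UNIV) H" and x: "\<And>n::nat. x n \<in> H"
  shows "\<exists>\<psi>\<in>H. \<forall>S e N. finite S \<and> 0 < e \<longrightarrow> (\<exists>n\<ge>N. \<forall>f\<in>S. \<bar>x n f - \<psi> f\<bar> < e)"
proof -
  define U where "U S e \<psi> = (\<Inter>f\<in>S. {\<phi> \<in> topspace (powertop_real UNIV). \<phi> f \<in> {\<psi> f - e <..< \<psi> f + e}}) \<inter> topspace (powertop_real UNIV)"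
    for S :: "'b set" and e :: real and \<psi> :: "'b \<Rightarrow> real"
  have U: "U S e \<psi> = {\<phi>. \<forall>f\<in>S. \<bar>\<phi> f - \<psi> f\<bar> < e}" for S e \<psi>
    by (auto simp: U_def abs_less_iff algebra_simps)
  have U_open: "openin (powertop_real UNIV) (U S e \<psi>)" if "finite S" for S e \<psi>
  proof (cases "S = {}")
    case True
    then show ?thesis using openin_topspace[of "powertop_real UNIV"] by (simp add: U)
  next
    case False
    then show ?thesis
      unfolding U_def using that
      by (intro openin_Int openin_INT openin_topspace
          openin_continuous_map_preimage[OF continuous_map_product_projection]) auto
  qed
  show ?thesis
  proof (rule ccontr)
    assume "\<not> ?thesis"
    then have "\<forall>\<psi>\<in>H. \<exists>S e N. finite S \<and> 0 < e \<and> (\<forall>n\<ge>N. x n \<notin> U S e \<psi>)" unfolding U by auto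
    then obtain S e N where *: "\<And>\<psi>. \<psi> \<in> H \<Longrightarrow> finite (S \<psi>) \<and> 0 < e \<psi> \<and> (\<forall>n\<ge>N \<psi>. x n \<notin> U (S \<psi>) (e \<psi>) \<psi>)"
      by metis
    let ?V = "\<lambda>\<psi>. U (S \<psi>) (e \<psi>) \<psi>"
    have cover: "H \<subseteq> \<Union>(?V ` H)"
    proof
      fix \<psi> assume "\<psi> \<in> H"
      moreover from this have "\<psi> \<in> ?V \<psi>" unfolding U using * by simp
      ultimately show "\<psi> \<in> \<Union>(?V ` H)" by blast
    qed
    have V: "openin (powertop_real UNIV) V" if "V \<in> ?V ` H" for V
      using that * U_open by auto
    obtain \<F> where \<F>: "finite \<F>" "\<F> \<subseteq> ?V ` H" "H \<subseteq> \<Union>\<F>"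
      using compactinD[OF H V cover] by metis
    obtain G where G: "finite G" "G \<subseteq> H" "\<F> = ?V ` G" using finite_subset_image[OF \<F>(1,2)] by metis
    define m where "m = Max (insert 0 (N ` G))"
    obtain \<psi> where "\<psi> \<in> G" "x m \<in> ?V \<psi>" using G(3) \<F>(3) x[of m] by blast
    moreover from this have "N \<psi> \<le> m" using G(1) by (simp add: m_def)
    ultimately show False using *[of \<psi>] G(2) by auto
  qed
qed

text \<open>A form of Phillips' lemma, by a gliding hump: if \<open>\<psi>\<close> is a cluster point of measures with
  large masses at far points \<open>k\<^sub>i\<close>, a subsequence that converges to \<open>\<psi>\<close> on singletons stays away
  from \<open>\<psi>\<close> on the set of its points \<open>k\<^sub>i\<close>, although every cluster point of it agrees with \<open>\<psi>\<close>
  there.\<close>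

lemma compact_additive_uniformly_null:
  fixes M :: "(nat set \<Rightarrow> real) set"
  assumes M: "compactin (powertop_real UNIV) M"
    and add: "\<And>\<mu> A B. \<mu> \<in> M \<Longrightarrow> A \<inter> B = {} \<Longrightarrow> \<mu> (A \<union> B) = \<mu> A + \<mu> B"
    and tail: "\<And>\<mu> e. \<mu> \<in> M \<Longrightarrow> 0 < e \<Longrightarrow> \<exists>N. \<forall>A. A \<subseteq> {N..} \<longrightarrow> \<bar>\<mu> A\<bar> \<le> e"
    and e: "0 < e"
  obtains N where "\<And>\<mu> k. \<mu> \<in> M \<Longrightarrow> N \<le> k \<Longrightarrow> \<bar>\<mu> {k}\<bar> \<le> e"
proof (rule ccontr)
  assume "\<not> thesis"
  then have "\<forall>N. \<exists>\<mu> k. \<mu> \<in> M \<and> N \<le> k \<and> e < \<bar>\<mu> {k}\<bar>" using that by (metis not_le)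
  then obtain \<mu> k where \<mu>: "\<And>j. \<mu> j \<in> M" and k: "\<And>j. j \<le> k j" and big: "\<And>j. e < \<bar>\<mu> j {k j}\<bar>" by metis
  obtain \<psi> where \<psi>: "\<psi> \<in> M" "\<And>S r N. finite S \<Longrightarrow> 0 < r \<Longrightarrow> \<exists>n\<ge>N. \<forall>A\<in>S. \<bar>\<mu> n A - \<psi> A\<bar> < r"
    using compactin_pointwise_cluster[of M \<mu>, OF M \<mu>] by blast
  \<comment> \<open>The hump exceeds \<open>4 * \<eta>\<close>. Three errors of at most
    \<open>\<eta>\<close> are subtracted: the deviation on earlier points, the tail of the current
    measure and the tail of \<open>\<psi>\<close>.\<close>
  define \<eta> where "\<eta> = e / 4"
  have \<eta>: "0 < \<eta>" using e by (simp add: \<eta>_def)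
  have empty: "\<nu> {} = 0" if "\<nu> \<in> M" for \<nu> using add[OF that, of "{}" "{}"] by simp
  have fin: "\<nu> A = (\<Sum>i\<in>A. \<nu> {i})" if "\<nu> \<in> M" "finite A" for \<nu> A
    using that(2)
  proof induction
    case (insert i A)
    then show ?case using add[OF that(1), of "{i}" A] by simp
  qed (simp add: empty[OF that(1)])
  have split: "\<nu> A = (\<Sum>i\<in>A \<inter> {..<n}. \<nu> {i}) + \<nu> (A \<inter> {n..})" if "\<nu> \<in> M" for \<nu> A n
  proof -
    have "A = (A \<inter> {..<n}) \<union> (A \<inter> {n..})" by auto
    then have "\<nu> A = \<nu> (A \<inter> {..<n}) + \<nu> (A \<inter> {n..})"
      using add[OF that, of "A \<inter> {..<n}" "A \<inter> {n..}"] by fastforce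
    then show ?thesis using fin[OF that, of "A \<inter> {..<n}"] by simp
  qed
  obtain N0 where N0: "\<And>A. A \<subseteq> {N0..} \<Longrightarrow> \<bar>\<psi> A\<bar> \<le> \<eta>" using tail[OF \<psi>(1) \<eta>] by metis
  \<comment> \<open>One stage of the hump: the large point lies in the window from \<open>m\<close>
    up to \<open>n\<close>, and the measure has little mass beyond it. The tolerance
    \<open>\<eta> / (m + 1)\<close> adds up to at most \<open>\<eta>\<close> over the points below
    \<open>m\<close> and tends to 0, which later identifies cluster points on singletons.\<close>
  define R where "R m jn \<longleftrightarrow> (case jn of (j, n) \<Rightarrow> m \<le> k j \<and> k j < n \<and>
      (\<forall>i<m. \<bar>\<mu> j {i} - \<psi> {i}\<bar> < \<eta> / (real m + 1)) \<and> (\<forall>A. A \<subseteq> {n..} \<longrightarrow> \<bar>\<mu> j A\<bar> \<le> \<eta>))" for m jn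
  have "\<exists>jn. R m jn" for m
  proof -
    have "finite ((\<lambda>i. {i}) ` {..<m})" "0 < \<eta> / (real m + 1)" using \<eta> by auto
    from \<psi>(2)[OF this, of m] obtain j where j: "m \<le> j" "\<And>i. i < m \<Longrightarrow> \<bar>\<mu> j {i} - \<psi> {i}\<bar> < \<eta> / (real m + 1)"
      by auto
    obtain n where n: "\<And>A. A \<subseteq> {n..} \<Longrightarrow> \<bar>\<mu> j A\<bar> \<le> \<eta>" using tail[OF \<mu> \<eta>] by metis
    have "R m (j, max n (Suc (k j)))"
      unfolding R_def using j(1) k[of j] by (auto intro!: j(2) n elim!: order_trans)
    then show ?thesis ..
  qed
  then obtain T where T: "\<And>m. R m (T m)" by metis
  \<comment> \<open>Starting at \<open>N0\<close> makes the tail of \<open>\<psi>\<close> small from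
    the first stage; each window begins where the previous one ends.\<close>
  define n where "n = rec_nat N0 (\<lambda>_ m. snd (T m))"
  define j where "j i = fst (T (n i))" for i
  have n0: "n 0 = N0" and nS: "n (Suc i) = snd (T (n i))" for i by (simp_all add: n_def)
  have "R (n i) (j i, n (Suc i))" for i using T[of "n i"] by (simp add: j_def nS)
  then have j1: "n i \<le> k (j i)" "k (j i) < n (Suc i)"
    and j2: "\<And>l. l < n i \<Longrightarrow> \<bar>\<mu> (j i) {l} - \<psi> {l}\<bar> < \<eta> / (real (n i) + 1)"
    and j3: "\<And>A. A \<subseteq> {n (Suc i)..} \<Longrightarrow> \<bar>\<mu> (j i) A\<bar> \<le> \<eta>" for i
    by (simp_all add: R_def)
  have nmono: "strict_mono n" using j1 by (intro strict_monoI_Suc) (meson le_less_trans)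
  define A where "A = range (\<lambda>i. k (j i))"
  \<comment> \<open>The windows are disjoint, so the \<open>i\<close>-th one contains exactly one
    point of \<open>A\<close>.\<close>
  have A: "A \<inter> {n i..} = {k (j i)} \<union> (A \<inter> {n (Suc i)..})" for i
  proof -
    have "l = i" if "n i \<le> k (j l)" "k (j l) < n (Suc i)" for l
    proof -
      have "n i < n (Suc l)" "n l < n (Suc i)" using j1[of l] that by linarith+
      then show ?thesis using nmono by (simp add: strict_mono_less)
    qed
    moreover have "n i \<le> a" if "n (Suc i) \<le> a" for a using j1[of i] that by linarith
    ultimately show ?thesis using j1(1)[of i] unfolding A_def by (force simp: not_le[symmetric])
  qed
  have far: "\<eta> < \<bar>\<mu> (j i) A - \<psi> A\<bar>" for i
  proof -
    let ?B = "A \<inter> {..<n i}"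
    have "\<mu> (j i) A = (\<Sum>l\<in>?B. \<mu> (j i) {l}) + (\<mu> (j i) {k (j i)} + \<mu> (j i) (A \<inter> {n (Suc i)..}))"
    proof -
      have "\<mu> (j i) (A \<inter> {n i..}) = \<mu> (j i) {k (j i)} + \<mu> (j i) (A \<inter> {n (Suc i)..})"
        by (subst A, rule add[OF \<mu>]) (use j1[of i] in auto)
      then show ?thesis using split[OF \<mu>, of "j i" A "n i"] by simp
    qed
    moreover have "\<psi> A = (\<Sum>l\<in>?B. \<psi> {l}) + \<psi> (A \<inter> {n i..})" by (rule split[OF \<psi>(1)])
    moreover have "\<bar>\<psi> (A \<inter> {n i..})\<bar> \<le> \<eta>"
    proof (rule N0)
      have "N0 \<le> n i" using n0 strict_mono_mono[OF nmono] by (metis monoD le0)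
      then show "A \<inter> {n i..} \<subseteq> {N0..}" by auto
    qed
    moreover have "\<bar>\<mu> (j i) (A \<inter> {n (Suc i)..})\<bar> \<le> \<eta>" by (rule j3) auto
    moreover have "\<bar>(\<Sum>l\<in>?B. \<mu> (j i) {l}) - (\<Sum>l\<in>?B. \<psi> {l})\<bar> \<le> \<eta>"
    proof -
      have "\<bar>(\<Sum>l\<in>?B. \<mu> (j i) {l}) - (\<Sum>l\<in>?B. \<psi> {l})\<bar> \<le> (\<Sum>l\<in>?B. \<bar>\<mu> (j i) {l} - \<psi> {l}\<bar>)"
        by (simp flip: sum_subtractf)
      also have "\<dots> \<le> (\<Sum>l\<in>?B. \<eta> / (real (n i) + 1))" by (intro sum_mono less_imp_le j2) auto
      also have "\<dots> = real (card ?B) * (\<eta> / (real (n i) + 1))" by simp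
      also have "\<dots> \<le> (real (n i) + 1) * (\<eta> / (real (n i) + 1))"
      proof (rule mult_right_mono)
        have "card ?B \<le> card {..<n i}" by (rule card_mono) auto
        then show "real (card ?B) \<le> real (n i) + 1" by simp
      qed (use \<eta> in simp)
      also have "\<dots> = \<eta>" by simp
      finally show ?thesis .
    qed
    ultimately show ?thesis using big[of "j i"] e unfolding \<eta>_def by linarith
  qed
  obtain \<psi>' where \<psi>': "\<psi>' \<in> M" "\<And>S r N. finite S \<Longrightarrow> 0 < r \<Longrightarrow> \<exists>i\<ge>N. \<forall>A\<in>S. \<bar>\<mu> (j i) A - \<psi>' A\<bar> < r"
    using compactin_pointwise_cluster[of M "\<lambda>i. \<mu> (j i)", OF M \<mu>] by blast
  have same: "\<psi>' {l} = \<psi> {l}" for l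
  proof (rule ccontr)
    assume "\<psi>' {l} \<noteq> \<psi> {l}"
    then have d: "0 < \<bar>\<psi>' {l} - \<psi> {l}\<bar> / 2" by simp
    obtain p where p: "\<eta> / (\<bar>\<psi>' {l} - \<psi> {l}\<bar> / 2) < real p" using reals_Archimedean2 by blast
    obtain i where i: "i \<ge> max p (Suc l)" "\<bar>\<mu> (j i) {l} - \<psi>' {l}\<bar> < \<bar>\<psi>' {l} - \<psi> {l}\<bar> / 2"
      using \<psi>'(2)[of "{{l}}", OF _ d, of "max p (Suc l)"] by blast
    have ni: "i \<le> n i" using nmono by (simp add: strict_mono_imp_increasing)
    then have "\<bar>\<mu> (j i) {l} - \<psi> {l}\<bar> < \<eta> / (real (n i) + 1)" using i(1) by (intro j2) simp
    also have "\<dots> \<le> \<bar>\<psi>' {l} - \<psi> {l}\<bar> / 2"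
    proof -
      have "real p \<le> real (n i) + 1" using i(1) ni by simp
      then have "\<eta> / (\<bar>\<psi>' {l} - \<psi> {l}\<bar> / 2) < real (n i) + 1" using p by linarith
      then show ?thesis using d by (simp add: field_simps)
    qed
    finally have "\<bar>\<mu> (j i) {l} - \<psi> {l}\<bar> < \<bar>\<psi>' {l} - \<psi> {l}\<bar> / 2" .
    moreover have "\<bar>\<psi>' {l} - \<psi> {l}\<bar> \<le> \<bar>\<mu> (j i) {l} - \<psi> {l}\<bar> + \<bar>\<mu> (j i) {l} - \<psi>' {l}\<bar>" by linarith
    ultimately show False using i(2) d by argo
  qed
  \<comment> \<open>Agreement on singletons gives agreement on finite sets; vanishing tails of both
    set functions extend it to \<open>A\<close>.\<close>
  have "\<psi>' A = \<psi> A"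
  proof (rule ccontr)
    assume "\<psi>' A \<noteq> \<psi> A"
    then have d: "0 < \<bar>\<psi>' A - \<psi> A\<bar> / 3" by simp
    obtain N1 where N1: "\<And>B. B \<subseteq> {N1..} \<Longrightarrow> \<bar>\<psi> B\<bar> \<le> \<bar>\<psi>' A - \<psi> A\<bar> / 3"
      using tail[OF \<psi>(1) d] by metis
    obtain N2 where N2: "\<And>B. B \<subseteq> {N2..} \<Longrightarrow> \<bar>\<psi>' B\<bar> \<le> \<bar>\<psi>' A - \<psi> A\<bar> / 3"
      using tail[OF \<psi>'(1) d] by metis
    let ?n = "max N1 N2"
    have "A \<inter> {?n..} \<subseteq> {N1..}" "A \<inter> {?n..} \<subseteq> {N2..}" by auto
    from N1[OF this(1)] N2[OF this(2)]
    have "\<bar>\<psi>' (A \<inter> {?n..}) - \<psi> (A \<inter> {?n..})\<bar> < \<bar>\<psi>' A - \<psi> A\<bar>"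
      using d abs_triangle_ineq4[of "\<psi>' (A \<inter> {?n..})" "\<psi> (A \<inter> {?n..})"] by argo
    moreover have "\<psi>' A - \<psi> A = \<psi>' (A \<inter> {?n..}) - \<psi> (A \<inter> {?n..})"
      using split[OF \<psi>(1), of A ?n] split[OF \<psi>'(1), of A ?n] by (simp add: same)
    ultimately show False by simp
  qed
  moreover obtain i where "\<bar>\<mu> (j i) A - \<psi>' A\<bar> < \<eta>" using \<psi>'(2)[of "{A}", OF _ \<eta>] by auto
  ultimately show False using far[of i] by simp
qed

subsection \<open>Separated bumps and tightness of weak-star compact sets\<close>

definition bcf_mult :: "('a::topological_space \<Rightarrow> real) \<Rightarrow> ('a \<Rightarrow>\<^sub>C real) \<Rightarrow> ('a \<Rightarrow>\<^sub>C real)" where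
  "bcf_mult u f = Bcontfun (\<lambda>x. u x * apply_bcontfun f x)"

lemma apply_bcf_mult:
  assumes "continuous_on UNIV u" "\<And>x. \<bar>u x\<bar> \<le> 1"
  shows "apply_bcontfun (bcf_mult u f) x = u x * apply_bcontfun f x"
proof -
  have "apply_bcontfun (bcf_mult u f) = (\<lambda>x. u x * apply_bcontfun f x)"
    unfolding bcf_mult_def
  proof (rule apply_Bcontfun[where b = "1 * norm f"])
    show "\<bar>u x * apply_bcontfun f x\<bar> \<le> 1 * norm f" for x
      unfolding abs_mult using assms(2) abs_bcontfun_le_norm by (intro mult_mono) auto
  qed (use assms(1) in \<open>auto intro!: continuous_intros\<close>)
  then show ?thesis by simp
qed

text \<open>Equal to 1 up to distance \<open>r\<close> from \<open>S\<close>, equal to 0 from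
  distance \<open>2 * r\<close> on, and affine in the distance between.\<close>

definition cutoff :: "'a::metric_space set \<Rightarrow> real \<Rightarrow> 'a \<Rightarrow> real" where
  "cutoff S r x = min 1 (max 0 (2 - infdist x S / r))"

lemma continuous_cutoff: "0 < r \<Longrightarrow> continuous_on UNIV (cutoff S r)"
  unfolding cutoff_def by (intro continuous_intros) auto

lemma cutoff_bounds: "0 \<le> cutoff S r x" "cutoff S r x \<le> 1" "\<bar>cutoff S r x\<bar> \<le> 1"
  by (auto simp: cutoff_def)

lemma cutoff_eq_1: "0 < r \<Longrightarrow> infdist x S \<le> r \<Longrightarrow> cutoff S r x = 1"
  by (auto simp: cutoff_def min_def max_def field_simps)

lemma cutoff_eq_0: "0 < r \<Longrightarrow> 2 * r \<le> infdist x S \<Longrightarrow> cutoff S r x = 0"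
  by (auto simp: cutoff_def min_def max_def field_simps)

lemma apply_mult_cutoff:
  "0 < r \<Longrightarrow> apply_bcontfun (bcf_mult (cutoff S r) f) x = cutoff S r x * apply_bcontfun f x"
  by (rule apply_bcf_mult[OF continuous_cutoff cutoff_bounds(3)])

lemma norm_mult_cutoff_le:
  assumes "0 < r"
  shows "norm (bcf_mult (cutoff S r) f) \<le> norm f"
proof (rule norm_bound)
  fix x
  have "\<bar>cutoff S r x * apply_bcontfun f x\<bar> \<le> 1 * norm f"
    unfolding abs_mult by (intro mult_mono cutoff_bounds abs_bcontfun_le_norm) auto
  then show "norm (apply_bcontfun (bcf_mult (cutoff S r) f) x) \<le> norm f"
    by (simp add: apply_mult_cutoff[OF assms])
qed

lemma norm_diff_mult_cutoff_le:
  assumes "0 < r"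
  shows "norm (f - bcf_mult (cutoff S r) f) \<le> norm f"
proof (rule norm_bound)
  fix x
  have "\<bar>(1 - cutoff S r x) * apply_bcontfun f x\<bar> \<le> 1 * norm f"
    unfolding abs_mult
    by (intro mult_mono abs_bcontfun_le_norm) (use cutoff_bounds[of S r x] in auto)
  then show "norm (apply_bcontfun (f - bcf_mult (cutoff S r) f) x) \<le> norm f"
    by (simp add: apply_mult_cutoff[OF assms] algebra_simps)
qed

lemma infdist_lessE:
  assumes "infdist x S < r" "S \<noteq> {}"
  obtains y where "y \<in> S" "dist x y < r"
  using assms that by (auto simp: infdist_notempty cINF_less_iff bdd_below_image_dist)

lemma compact_finite_net:
  fixes K :: "'a::metric_space set"
  assumes "compact K" "0 < r"
  obtains F where "finite F" "F \<noteq> {}" "\<And>x. x \<in> K \<Longrightarrow> infdist x F < r"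
proof -
  obtain F where F: "finite F" "K \<subseteq> (\<Union>x\<in>F. ball x r)"
    using assms unfolding compact_eq_totally_bounded by blast
  \<comment> \<open>The extra point keeps the net nonempty even for empty \<open>K\<close>; the
    distance to the empty set is 0 by convention, so an empty net would be meaningless.\<close>
  have "infdist x (insert undefined F) < r" if "x \<in> K" for x
  proof -
    obtain y where "y \<in> F" "dist y x < r" using F(2) \<open>x \<in> K\<close> by auto
    then show ?thesis using infdist_le[of y "insert undefined F" x] by (simp add: dist_commute)
  qed
  then show ?thesis using that[of "insert undefined F"] F(1) by blast
qed

section \<open>Strictly continuous functionals and sums of separated bumps\<close>

lemma continuous_dual_strict:
  assumes "\<phi> \<in> continuous_dual strict_topology"
  shows "linear \<phi>" "seminorm (\<lambda>f. \<bar>\<phi> f\<bar>)"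
    and "continuous_map strict_topology euclideanreal (\<lambda>f. \<bar>\<phi> f\<bar>)"
    and "continuous_on UNIV \<phi>"
proof -
  show lin: "linear \<phi>" using assms by (simp add: continuous_dual_def)
  have cont: "continuous_map strict_topology euclideanreal \<phi>"
    using assms by (simp add: continuous_dual_def)
  show "seminorm (\<lambda>f. \<bar>\<phi> f\<bar>)"
    by (simp add: seminorm_def linear_add[OF lin] linear_scale[OF lin] abs_mult abs_triangle_ineq)
  show "continuous_map strict_topology euclideanreal (\<lambda>f. \<bar>\<phi> f\<bar>)"
    by (rule continuous_map_real_abs[OF cont])
  have "open (\<phi> -` B)" if "open B" for B
    using open_strict_topology[OF openin_continuous_map_preimage[OF cont, of B]] that
    by (simp add: vimage_def strict_topology_eq topspace_seminorm_topology[OF directed_strict_seminorms])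
  then show "continuous_on UNIV \<phi>" by (simp add: continuous_on_open_vimage)
qed

lemma continuous_dual_strict_tight:
  assumes "\<phi> \<in> continuous_dual strict_topology" "0 < e"
  obtains K where "compact K"
    "\<And>f. norm f \<le> 1 \<Longrightarrow> (\<And>x. x \<in> K \<Longrightarrow> apply_bcontfun f x = 0) \<Longrightarrow> \<bar>\<phi> f\<bar> \<le> e"
proof -
  have "uniformly_tight {\<lambda>f. \<bar>\<phi> f\<bar>}"
    by (rule continuous_seminorm_tight[OF continuous_dual_strict(2,3)[OF assms(1)]])
  then obtain K where "compact K" "\<forall>f. norm f \<le> 1 \<and> (\<forall>x\<in>K. apply_bcontfun f x = 0) \<longrightarrow> \<bar>\<phi> f\<bar> \<le> e"
    unfolding uniformly_tight_def using assms(2) by (metis abs_idempotent singletonI)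
  then show ?thesis by (intro that[of K]) auto
qed

text \<open>Sums of functions with uniformly separated supports: at each point at most one term of the
  series is nonzero.\<close>

definition separated_sum :: "(nat \<Rightarrow> 'a::metric_space \<Rightarrow>\<^sub>C real) \<Rightarrow> nat set \<Rightarrow> ('a \<Rightarrow>\<^sub>C real)" where
  "separated_sum g A = Bcontfun (\<lambda>x. \<Sum>k. indicat_real A k * apply_bcontfun (g k) x)"

locale separated_functions =
  fixes g :: "nat \<Rightarrow> 'a::metric_space \<Rightarrow>\<^sub>C real" and r :: real
  assumes r_pos: "0 < r"
    and norm_le: "\<And>k. norm (g k) \<le> 1"
    and sep: "\<And>j k x y. j < k \<Longrightarrow> apply_bcontfun (g j) x \<noteq> 0 \<Longrightarrow> apply_bcontfun (g k) y \<noteq> 0 \<Longrightarrow> r < dist x y"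
begin

lemma sep': "j \<noteq> k \<Longrightarrow> apply_bcontfun (g j) x \<noteq> 0 \<Longrightarrow> apply_bcontfun (g k) y \<noteq> 0 \<Longrightarrow> r < dist x y"
  using sep[of j k x y] sep[of k j y x] by (auto simp: dist_commute neq_iff)

text \<open>Two points of a ball of radius \<open>r / 2\<close> are closer than \<open>r\<close>, so
  they cannot lie in the supports of different terms.\<close>

lemma single_index:
  obtains k where "\<And>j y. j \<noteq> k \<Longrightarrow> y \<in> ball x (r / 2) \<Longrightarrow> apply_bcontfun (g j) y = 0"
proof (cases "\<exists>k. \<exists>y\<in>ball x (r / 2). apply_bcontfun (g k) y \<noteq> 0")
  case True
  then obtain k y where k: "y \<in> ball x (r / 2)" "apply_bcontfun (g k) y \<noteq> 0" by blast
  have "apply_bcontfun (g j) z = 0" if "j \<noteq> k" "z \<in> ball x (r / 2)" for j z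
  proof (rule ccontr)
    assume "apply_bcontfun (g j) z \<noteq> 0"
    then have "r < dist z y" using sep'[OF that(1)] k(2) by blast
    then show False using dist_triangle_half_r[of x z r y] k(1) that(2) by (simp add: dist_commute)
  qed
  then show ?thesis using that by blast
qed (use that in blast)

lemma suminf_single:
  assumes "\<And>j. j \<noteq> k \<Longrightarrow> apply_bcontfun (g j) y = 0"
  shows "(\<Sum>j. indicat_real A j * apply_bcontfun (g j) y) = indicat_real A k * apply_bcontfun (g k) y"
  using suminf_finite[of "{k}" "\<lambda>j. indicat_real A j * apply_bcontfun (g j) y"] assms
  by (auto simp: indicator_def)

text \<open>\<open>Bcontfun\<close> is meaningful only for bounded continuous functions. Locally the
  series is a single term, which yields both properties.\<close>

lemma apply_separated_sum:
  "apply_bcontfun (separated_sum g A) x = (\<Sum>k. indicat_real A k * apply_bcontfun (g k) x)"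
proof -
  let ?h = "\<lambda>x. \<Sum>k. indicat_real A k * apply_bcontfun (g k) x"
  have "continuous (at x) ?h" for x
  proof -
    obtain k where k: "\<And>j y. j \<noteq> k \<Longrightarrow> y \<in> ball x (r / 2) \<Longrightarrow> apply_bcontfun (g j) y = 0"
      using single_index[of x] by metis
    have "continuous_on (ball x (r / 2)) (\<lambda>y. indicat_real A k * apply_bcontfun (g k) y)"
      by (intro continuous_on_mult continuous_on_const continuous_on_subset[OF continuous_on_apply_bcontfun]) auto
    then have "continuous_on (ball x (r / 2)) ?h"
      by (rule continuous_on_eq) (use k in \<open>simp add: suminf_single[of k]\<close>)
    then show ?thesis using r_pos by (simp add: continuous_on_eq_continuous_at)
  qed
  moreover have "\<bar>?h x\<bar> \<le> 1" for x
  proof -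
    obtain k where k: "\<And>j y. j \<noteq> k \<Longrightarrow> y \<in> ball x (r / 2) \<Longrightarrow> apply_bcontfun (g j) y = 0"
      using single_index[of x] by metis
    have "\<bar>apply_bcontfun (g k) x\<bar> \<le> 1" using abs_bcontfun_le_norm[of "g k" x] norm_le[of k] by linarith
    then show ?thesis using suminf_single[of k x A] k r_pos by (auto simp: indicator_def)
  qed
  ultimately have "apply_bcontfun (separated_sum g A) = ?h"
    unfolding separated_sum_def by (intro apply_Bcontfun) (auto simp: continuous_on_eq_continuous_at)
  then show ?thesis by simp
qed

text \<open>At a given point the same index serves every \<open>A\<close>, so identities and bounds
  for the sums reduce to indicator functions.\<close>

lemma separated_sum_at:
  obtains k where "\<And>A. apply_bcontfun (separated_sum g A) x = indicat_real A k * apply_bcontfun (g k) x"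
proof -
  obtain k where k: "\<And>j y. j \<noteq> k \<Longrightarrow> y \<in> ball x (r / 2) \<Longrightarrow> apply_bcontfun (g j) y = 0"
    using single_index[of x] by metis
  show thesis
    by (rule that[of k], subst apply_separated_sum, rule suminf_single) (use k r_pos in auto)
qed

lemma separated_sum_Un:
  assumes "A \<inter> B = {}"
  shows "separated_sum g (A \<union> B) = separated_sum g A + separated_sum g B"
proof (rule bcontfun_eqI)
  fix x
  obtain k where "\<And>A. apply_bcontfun (separated_sum g A) x = indicat_real A k * apply_bcontfun (g k) x"
    using separated_sum_at[of x] by metis
  then show "apply_bcontfun (separated_sum g (A \<union> B)) x = apply_bcontfun (separated_sum g A + separated_sum g B) x"
    using assms by (auto simp: indicator_def)
qed

lemma separated_sum_singleton: "separated_sum g {k} = g k"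
proof (rule bcontfun_eqI)
  fix x show "apply_bcontfun (separated_sum g {k}) x = apply_bcontfun (g k) x"
    using suminf_finite[of "{k}" "\<lambda>j. indicat_real {k} j * apply_bcontfun (g j) x"]
    by (auto simp: apply_separated_sum indicator_def)
qed

lemma norm_separated_sum_le: "norm (separated_sum g A) \<le> 1"
proof (rule norm_bound)
  fix x
  obtain k where "\<And>A. apply_bcontfun (separated_sum g A) x = indicat_real A k * apply_bcontfun (g k) x"
    using separated_sum_at[of x] by metis
  moreover have "\<bar>apply_bcontfun (g k) x\<bar> \<le> 1" using abs_bcontfun_le_norm[of "g k" x] norm_le[of k] by linarith
  ultimately show "norm (apply_bcontfun (separated_sum g A) x) \<le> 1" by (auto simp: indicator_def)
qed

text \<open>Finitely many balls of radius \<open>r / 2\<close> cover \<open>K\<close>, and each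
  meets the support of at most one term.\<close>

lemma zero_on_compact:
  assumes "compact K"
  obtains N where "\<And>k x. N \<le> k \<Longrightarrow> x \<in> K \<Longrightarrow> apply_bcontfun (g k) x = 0"
proof -
  have "\<exists>k. \<forall>j y. j \<noteq> k \<longrightarrow> y \<in> ball x (r / 2) \<longrightarrow> apply_bcontfun (g j) y = 0" for x
    using single_index[of x] by metis
  then obtain m where m: "\<And>x j y. j \<noteq> m x \<Longrightarrow> y \<in> ball x (r / 2) \<Longrightarrow> apply_bcontfun (g j) y = 0"
    by metis
  obtain F where F: "finite F" "K \<subseteq> (\<Union>x\<in>F. ball x (r / 2))"
    using assms r_pos unfolding compact_eq_totally_bounded by (meson half_gt_zero)
  have "apply_bcontfun (g k) x = 0" if k: "Suc (Max (insert 0 (m ` F))) \<le> k" and x: "x \<in> K" for k x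
  proof -
    obtain z where z: "z \<in> F" "x \<in> ball z (r / 2)" using F(2) x by blast
    have "m z \<le> Max (insert 0 (m ` F))" using F(1) z(1) by simp
    then have "k \<noteq> m z" using k by linarith
    then show ?thesis using m z(2) by blast
  qed
  then show ?thesis by (rule that)
qed

text \<open>Evaluation at the sums is weak-star continuous, so \<open>H\<close> turns into a compact
  family of additive set functions on the naturals. Their tails are small because each functional is
  tight and late terms vanish on its compact set; the Phillips lemma then applies to
  singletons.\<close>

lemma weak_star_compact_null:
  assumes H: "compactin (weak_star_topology strict_topology) H" and e: "0 < e"
  obtains N where "\<And>\<phi> k. \<phi> \<in> H \<Longrightarrow> N \<le> k \<Longrightarrow> \<bar>\<phi> (g k)\<bar> \<le> e"
proof -
  let ?\<Phi> = "\<lambda>\<phi> A. \<phi> (separated_sum g A)"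
  have dual: "\<phi> \<in> continuous_dual strict_topology" if "\<phi> \<in> H" for \<phi>
    using H that by (auto simp: weak_star_topology_def compactin_subtopology)
  have "compactin (powertop_real UNIV) H"
    using H by (simp add: weak_star_topology_def compactin_subtopology)
  moreover have "continuous_map (powertop_real UNIV) (powertop_real UNIV) ?\<Phi>"
    unfolding continuous_map_componentwise_UNIV by (intro allI continuous_map_product_projection UNIV_I)
  ultimately have M: "compactin (powertop_real UNIV) (?\<Phi> ` H)" by (rule image_compactin)
  have add: "\<mu> (A \<union> B) = \<mu> A + \<mu> B" if "\<mu> \<in> ?\<Phi> ` H" "A \<inter> B = {}" for \<mu> A B
    using that separated_sum_Un[OF that(2)] linear_add[OF continuous_dual_strict(1)[OF dual]] by auto
  have tail: "\<exists>N. \<forall>A. A \<subseteq> {N..} \<longrightarrow> \<bar>\<mu> A\<bar> \<le> d" if \<mu>: "\<mu> \<in> ?\<Phi> ` H" and d: "0 < d" for \<mu> d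
  proof -
    obtain \<phi> where \<phi>: "\<phi> \<in> H" "\<mu> = ?\<Phi> \<phi>" using \<mu> by blast
    obtain K where K: "compact K"
      "\<And>f. norm f \<le> 1 \<Longrightarrow> (\<And>x. x \<in> K \<Longrightarrow> apply_bcontfun f x = 0) \<Longrightarrow> \<bar>\<phi> f\<bar> \<le> d"
      using continuous_dual_strict_tight[OF dual[OF \<phi>(1)] d] by metis
    obtain N where N: "\<And>k x. N \<le> k \<Longrightarrow> x \<in> K \<Longrightarrow> apply_bcontfun (g k) x = 0"
      using zero_on_compact[OF K(1)] by metis
    have "\<bar>\<mu> A\<bar> \<le> d" if A: "A \<subseteq> {N..}" for A
      unfolding \<phi>(2)
    proof (rule K(2)[OF norm_separated_sum_le])
      fix x assume x: "x \<in> K"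
      have "(\<lambda>k. indicat_real A k * apply_bcontfun (g k) x) = (\<lambda>_. 0)"
        using N[OF _ x] A by (auto simp: indicator_def fun_eq_iff)
      then show "apply_bcontfun (separated_sum g A) x = 0" by (simp only: apply_separated_sum suminf_zero)
    qed
    then show ?thesis by blast
  qed
  obtain N where N: "\<And>\<mu> k. \<mu> \<in> ?\<Phi> ` H \<Longrightarrow> N \<le> k \<Longrightarrow> \<bar>\<mu> {k}\<bar> \<le> e"
    using compact_additive_uniformly_null[OF M add tail e] by blast
  have "\<bar>\<phi> (g k)\<bar> \<le> e" if "\<phi> \<in> H" "N \<le> k" for \<phi> k
    using N[OF imageI[OF that(1)] that(2)] by (simp add: separated_sum_singleton)
  then show ?thesis by (rule that)
qed

end

section \<open>From finite nets to one compact set, and equicontinuity\<close>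

text \<open>Each failure of a finite set yields a bump away from it, and a finite net of that bump's
  support is added before the next choice. The nonemptiness of \<open>F\<close> keeps the conclusion
  meaningful, since \<open>infdist\<close> to the empty set is 0 everywhere.\<close>

lemma weak_star_compact_finite_net:
  fixes H :: "(('a::metric_space \<Rightarrow>\<^sub>C real) \<Rightarrow> real) set"
  assumes H: "compactin (weak_star_topology strict_topology) H" and e: "0 < e" and d: "0 < d"
  obtains F where "finite F" "F \<noteq> {}"
    "\<And>\<phi> f. \<phi> \<in> H \<Longrightarrow> norm f \<le> 1 \<Longrightarrow> (\<And>x. infdist x F \<le> d \<Longrightarrow> apply_bcontfun f x = 0) \<Longrightarrow> \<bar>\<phi> f\<bar> \<le> e"
proof (rule ccontr)
  note result = that
  assume neg: "\<not> thesis"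
  have dual: "\<phi> \<in> continuous_dual strict_topology" if "\<phi> \<in> H" for \<phi>
    using H that by (auto simp: weak_star_topology_def compactin_subtopology)
  define R where "R F \<phi> g F' \<longleftrightarrow> \<phi> \<in> H \<and> norm g \<le> 1 \<and> e / 2 < \<bar>\<phi> g\<bar> \<and> finite F' \<and> F' \<noteq> {} \<and>
      (\<forall>x. infdist x F \<le> d \<longrightarrow> apply_bcontfun g x = 0) \<and>
      (\<forall>x. apply_bcontfun g x \<noteq> 0 \<longrightarrow> infdist x F' < d / 2)" for F \<phi> g F'
  have "\<exists>\<phi> g F'. R F \<phi> g F'" if F: "finite F" "F \<noteq> {}" for F
  proof -
    obtain \<phi> f where \<phi>: "\<phi> \<in> H" and f: "norm f \<le> 1" "\<And>x. infdist x F \<le> d \<Longrightarrow> apply_bcontfun f x = 0"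
      and big: "e < \<bar>\<phi> f\<bar>"
      using neg result[OF F] by (metis not_le)
    obtain K where K: "compact K"
      "\<And>f. norm f \<le> 1 \<Longrightarrow> (\<And>x. x \<in> K \<Longrightarrow> apply_bcontfun f x = 0) \<Longrightarrow> \<bar>\<phi> f\<bar> \<le> e / 2"
      using continuous_dual_strict_tight[OF dual[OF \<phi>], of "e / 2"] e by auto
    have d4: "0 < d / 4" using d by simp
    obtain F' where F': "finite F'" "F' \<noteq> {}" "\<And>x. x \<in> K \<Longrightarrow> infdist x F' < d / 4"
      using compact_finite_net[OF K(1) d4] by metis
    \<comment> \<open>The bump is localised near a finite net of the compact set of
      \<open>\<phi>\<close> itself. The discarded part vanishes on that compact set, so at most
      \<open>e / 2\<close> is lost.\<close>
    define g where "g = bcf_mult (cutoff F' (d / 4)) f"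
    have g: "apply_bcontfun g x = cutoff F' (d / 4) x * apply_bcontfun f x" for x
      unfolding g_def by (rule apply_mult_cutoff[OF d4])
    have "\<bar>\<phi> (f - g)\<bar> \<le> e / 2"
    proof (rule K(2))
      show "norm (f - g) \<le> 1" unfolding g_def using norm_diff_mult_cutoff_le[OF d4] f(1) by (rule order_trans)
      fix x assume "x \<in> K"
      then show "apply_bcontfun (f - g) x = 0" using cutoff_eq_1[OF d4, of x F'] F'(3)[of x] by (simp add: g)
    qed
    then have "e / 2 < \<bar>\<phi> g\<bar>"
      using big linear_diff[OF continuous_dual_strict(1)[OF dual[OF \<phi>]], of f g] by linarith
    moreover have "norm g \<le> 1" unfolding g_def using norm_mult_cutoff_le[OF d4] f(1) by (rule order_trans)
    moreover have "infdist x F' < d / 2" if "apply_bcontfun g x \<noteq> 0" for x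
      using cutoff_eq_0[OF d4, of x F'] that by (force simp: g)
    ultimately have "R F \<phi> g F'" using \<phi> f(2) F' by (simp add: R_def g)
    then show ?thesis by blast
  qed
  then obtain \<Phi> G N where T: "\<And>F. finite F \<Longrightarrow> F \<noteq> {} \<Longrightarrow> R F (\<Phi> F) (G F) (N F)" by metis
  define F where "F = rec_nat {undefined} (\<lambda>_ F. F \<union> N F)"
  have F0: "F 0 = {undefined}" and FS: "F (Suc n) = F n \<union> N (F n)" for n by (simp_all add: F_def)
  have fin: "finite (F n) \<and> F n \<noteq> {}" for n
  proof (induction n)
    case (Suc n)
    then have "finite (N (F n))" using T[of "F n"] unfolding R_def by blast
    then show ?case using Suc by (simp add: FS)
  qed (simp add: F0)
  define \<phi> where "\<phi> n = \<Phi> (F n)" for n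
  define g where "g n = G (F n)" for n
  define F' where "F' n = N (F n)" for n
  have "R (F n) (\<phi> n) (g n) (F' n)" for n unfolding \<phi>_def g_def F'_def using T fin by blast
  then have R: "\<phi> n \<in> H" "norm (g n) \<le> 1" "e / 2 < \<bar>\<phi> n (g n)\<bar>" "F' n \<noteq> {}"
    "infdist x (F n) \<le> d \<Longrightarrow> apply_bcontfun (g n) x = 0"
    "apply_bcontfun (g n) x \<noteq> 0 \<Longrightarrow> infdist x (F' n) < d / 2" for n x
    unfolding R_def by blast+
  have sub: "F' j \<subseteq> F k" if "j < k" for j k
  proof -
    have "F (Suc j) \<subseteq> F k" by (rule lift_Suc_mono_le[of F]) (use that in \<open>auto simp: FS\<close>)
    then show ?thesis by (simp add: FS F'_def)
  qed
  interpret separated_functions g "d / 2"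
  proof
    fix j k :: nat and x y assume jk: "j < k" and x: "apply_bcontfun (g j) x \<noteq> 0" and y: "apply_bcontfun (g k) y \<noteq> 0"
    show "d / 2 < dist x y"
    \<comment> \<open>The earlier bump lives within \<open>d / 2\<close> of its net. A point of the
      later support at distance at most \<open>d / 2\<close> from it would lie within
      \<open>d\<close> of \<open>F k\<close>, where the later bump vanishes.\<close>
    proof (rule ccontr)
      assume "\<not> d / 2 < dist x y"
      then have "infdist y (F' j) \<le> d"
        using R(6)[OF x] infdist_triangle[of y "F' j" x] by (simp add: dist_commute)
      then have "infdist y (F k) \<le> d" using infdist_mono[OF sub[OF jk] R(4), of y] by linarith
      then show False using R(5) y by blast
    qed
  qed (use d R(2) in auto)
  obtain N where "\<And>\<phi> k. \<phi> \<in> H \<Longrightarrow> N \<le> k \<Longrightarrow> \<bar>\<phi> (g k)\<bar> \<le> e / 2"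
    using weak_star_compact_null[OF H, of "e / 2"] e by auto
  then show False using R(1)[of N] R(3)[of N] by force
qed

lemma weak_star_compact_dual:
  "compactin (weak_star_topology \<tau>) H \<Longrightarrow> \<phi> \<in> H \<Longrightarrow> \<phi> \<in> continuous_dual \<tau>"
  by (auto simp: weak_star_topology_def compactin_subtopology)

lemma weak_star_compact_bounded:
  fixes H :: "(('a::metric_space \<Rightarrow>\<^sub>C real) \<Rightarrow> real) set"
  assumes H: "compactin (weak_star_topology strict_topology) H"
  obtains C where "0 \<le> C" "\<And>\<phi> f. \<phi> \<in> H \<Longrightarrow> \<bar>\<phi> f\<bar> \<le> C * norm f"
proof (rule uniform_boundedness_real[of H])
  show "linear \<phi>" "continuous_on UNIV \<phi>" if "\<phi> \<in> H" for \<phi>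
    using continuous_dual_strict(1,4)[OF weak_star_compact_dual[OF H that]] by simp_all
  fix f
  have "compactin (powertop_real UNIV) H"
    using H by (simp add: weak_star_topology_def compactin_subtopology)
  then have "compactin euclideanreal ((\<lambda>\<phi>. \<phi> f) ` H)"
    by (rule image_compactin) (rule continuous_map_product_projection[OF UNIV_I])
  then have "bounded ((\<lambda>\<phi>. \<phi> f) ` H)" by (simp add: compact_imp_bounded)
  then show "\<exists>B. \<forall>\<phi>\<in>H. \<bar>\<phi> f\<bar> \<le> B" by (simp add: bounded_iff)
qed (use that in blast)

text \<open>At every scale some \<open>F n\<close> is a finite net, so the closed intersection is
  totally bounded; completeness of the space does the rest.\<close>

lemma compact_Inter_infdist:
  fixes F :: "nat \<Rightarrow> 'a::complete_space set"
  assumes F: "\<And>n. finite (F n)" "\<And>n. F n \<noteq> {}" and d: "d \<longlonglongrightarrow> 0"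
  shows "compact (\<Inter>n. {x. infdist x (F n) \<le> d n})"
proof -
  let ?K = "\<Inter>n. {x. infdist x (F n) \<le> d n}"
  have "closed ?K" by (intro closed_INT ballI closed_Collect_le continuous_intros)
  moreover have "\<exists>k. finite k \<and> ?K \<subseteq> (\<Union>x\<in>k. ball x e)" if e: "0 < e" for e
  proof -
    obtain n where n: "d n < e"
      using order_tendstoD(2)[OF d e] by (auto simp: eventually_sequentially)
    have "?K \<subseteq> (\<Union>x\<in>F n. ball x e)"
    proof
      fix x assume "x \<in> ?K"
      then have "infdist x (F n) \<le> d n" by blast
      then have "infdist x (F n) < e" using n by linarith
      then obtain y where "y \<in> F n" "dist x y < e" using infdist_lessE[OF _ F(2)] by metis
      then show "x \<in> (\<Union>x\<in>F n. ball x e)" by (auto simp: dist_commute)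
    qed
    then show ?thesis using F(1) by blast
  qed
  ultimately show ?thesis by (simp add: compact_eq_totally_bounded complete_eq_closed)
qed

text \<open>This replaces vanishing on \<open>K\<close> by smallness on \<open>K\<close>:
  subtracting the truncation at height \<open>c\<close> makes \<open>f\<close> vanish there, and the
  truncation costs at most \<open>C * c\<close>.\<close>

lemma small_on_compact:
  fixes \<phi> :: "('a::metric_space \<Rightarrow>\<^sub>C real) \<Rightarrow> real"
  assumes \<phi>: "linear \<phi>" "\<And>f. \<bar>\<phi> f\<bar> \<le> C * norm f" and C: "0 \<le> C"
    and K: "\<And>f. norm f \<le> 1 \<Longrightarrow> (\<And>x. x \<in> K \<Longrightarrow> apply_bcontfun f x = 0) \<Longrightarrow> \<bar>\<phi> f\<bar> \<le> e"
    and f: "norm f \<le> 1" "\<And>x. x \<in> K \<Longrightarrow> \<bar>apply_bcontfun f x\<bar> \<le> c" and c: "0 < c"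
  shows "\<bar>\<phi> f\<bar> \<le> e + C * c"
proof -
  have "\<bar>\<phi> (f - bcf_trunc c f)\<bar> \<le> e"
  proof (rule K)
    have "norm (apply_bcontfun (f - bcf_trunc c f) x) \<le> 1" for x
      using abs_bcontfun_le_norm[of f x] f(1) c by (auto simp: apply_bcf_trunc max_def min_def)
    then show "norm (f - bcf_trunc c f) \<le> 1" by (rule norm_bound)
    show "apply_bcontfun (f - bcf_trunc c f) x = 0" if "x \<in> K" for x
      using f(2)[OF that] by (auto simp: apply_bcf_trunc max_def min_def abs_le_iff)
  qed
  moreover have "\<bar>\<phi> (bcf_trunc c f)\<bar> \<le> C * c"
    using \<phi>(2)[of "bcf_trunc c f"] mult_left_mono[OF norm_bcf_trunc_le[of c f] C] c by linarith
  moreover have "\<phi> f = \<phi> (f - bcf_trunc c f) + \<phi> (bcf_trunc c f)"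
    by (simp add: linear_diff[OF \<phi>(1)])
  ultimately show ?thesis by linarith
qed

text \<open>The set \<open>K\<close> is fixed by the finite nets alone. For a given \<open>f\<close>
  vanishing on \<open>K\<close>, cutoffs are applied until the product is small on a compact set
  \<open>L\<close> belonging to \<open>\<phi>\<close>; how many are needed depends on
  \<open>f\<close> and \<open>\<phi>\<close>, but their total cost never exceeds
  \<open>e / 2\<close>.\<close>

lemma weak_star_compact_tight:
  fixes H :: "(('a::complete_space \<Rightarrow>\<^sub>C real) \<Rightarrow> real) set"
  assumes H: "compactin (weak_star_topology strict_topology) H"
  shows "uniformly_tight H"
  unfolding uniformly_tight_def
proof (intro allI impI)
  fix e :: real assume e: "0 < e"
  define d :: "nat \<Rightarrow> real" where "d n = (1/2) ^ n" for n
  have d: "0 < d n" for n by (simp add: d_def)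
  have "\<exists>F. finite F \<and> F \<noteq> {} \<and> (\<forall>\<phi>\<in>H. \<forall>f. norm f \<le> 1 \<longrightarrow>
      (\<forall>x. infdist x F \<le> d n \<longrightarrow> apply_bcontfun f x = 0) \<longrightarrow> \<bar>\<phi> f\<bar> \<le> e / 4 * d n)" for n
  proof -
    have "0 < e / 4 * d n" using e d by simp
    from weak_star_compact_finite_net[OF H this d[of n]] show ?thesis by metis
  qed
  then obtain F where F: "\<And>n. finite (F n)" "\<And>n. F n \<noteq> {}"
    "\<And>n \<phi> f. \<phi> \<in> H \<Longrightarrow> norm f \<le> 1 \<Longrightarrow> (\<And>x. infdist x (F n) \<le> d n \<Longrightarrow> apply_bcontfun f x = 0) \<Longrightarrow>
      \<bar>\<phi> f\<bar> \<le> e / 4 * d n"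
    by metis
  \<comment> \<open>The radius is doubled because the cutoff at scale \<open>d n\<close> reaches 0
    only at distance \<open>2 * d n\<close>.\<close>
  define K where "K = (\<Inter>n. {x. infdist x (F n) \<le> 2 * d n})"
  have "(\<lambda>n. 2 * d n) \<longlonglongrightarrow> 2 * 0"
    unfolding d_def by (intro tendsto_mult tendsto_const LIMSEQ_power_zero) simp
  then have "compact K" unfolding K_def by (intro compact_Inter_infdist F) simp
  moreover have "\<bar>\<phi> f\<bar> \<le> e" if \<phi>: "\<phi> \<in> H" and f: "norm f \<le> 1" "\<And>x. x \<in> K \<Longrightarrow> apply_bcontfun f x = 0" for \<phi> f
  proof -
    have dual: "\<phi> \<in> continuous_dual strict_topology" by (rule weak_star_compact_dual[OF H \<phi>])
    note lin = continuous_dual_strict(1)[OF dual]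
    define W where "W = rec_nat f (\<lambda>n. bcf_mult (cutoff (F n) (d n)))"
    have W0: "W 0 = f" and WS: "W (Suc n) = bcf_mult (cutoff (F n) (d n)) (W n)" for n
      by (simp_all add: W_def)
    have normW: "norm (W n) \<le> 1" for n
    proof (induction n)
      case (Suc n)
      then show ?case using norm_mult_cutoff_le[OF d[of n], of "F n" "W n"] by (simp add: WS)
    qed (simp add: W0 f)
    have W_le: "\<bar>apply_bcontfun (W n) x\<bar> \<le> \<bar>apply_bcontfun f x\<bar>" for n x
    proof (induction n)
      case (Suc n)
      have "\<bar>cutoff (F n) (d n) x * apply_bcontfun (W n) x\<bar> \<le> 1 * \<bar>apply_bcontfun f x\<bar>"
        unfolding abs_mult by (intro mult_mono cutoff_bounds Suc) auto
      then show ?case by (simp add: WS apply_mult_cutoff[OF d])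
    qed (simp add: W0)
    have W_0: "apply_bcontfun (W n) x = 0" if "i < n" "2 * d i \<le> infdist x (F i)" for n x i
      using that(1)
    proof (induction n)
      case (Suc n)
      then show ?case
        using cutoff_eq_0[OF d that(2)] by (cases "i = n") (auto simp: WS apply_mult_cutoff[OF d])
    qed simp
    have step: "\<bar>\<phi> (W n - W (Suc n))\<bar> \<le> e / 4 * d n" for n
    proof (rule F(3)[OF \<phi>])
      show "norm (W n - W (Suc n)) \<le> 1"
        unfolding WS using norm_diff_mult_cutoff_le[OF d] normW by (rule order_trans)
      show "apply_bcontfun (W n - W (Suc n)) x = 0" if "infdist x (F n) \<le> d n" for x
        using cutoff_eq_1[OF d that] by (simp add: WS apply_mult_cutoff[OF d])
    qed
    have sum: "\<bar>\<phi> f\<bar> \<le> (\<Sum>i<n. e / 4 * d i) + \<bar>\<phi> (W n)\<bar>" for n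
    proof (induction n)
      case (Suc n)
      have "\<bar>\<phi> (W n)\<bar> \<le> \<bar>\<phi> (W n - W (Suc n))\<bar> + \<bar>\<phi> (W (Suc n))\<bar>"
        using linear_diff[OF lin, of "W n" "W (Suc n)"] by linarith
      then show ?case using Suc step[of n] unfolding sum.lessThan_Suc by linarith
    qed (simp add: W0)
    have geo: "(\<Sum>i<n. e / 4 * d i) \<le> e / 2" for n
    proof -
      have "(\<Sum>i<n. d i) \<le> (\<Sum>i. d i)" unfolding d_def by (rule sum_le_suminf) auto
      also have "\<dots> = 2" unfolding d_def by (simp add: suminf_geometric)
      finally have "e / 4 * (\<Sum>i<n. d i) \<le> e / 4 * 2" using e by (intro mult_left_mono) auto
      then show ?thesis by (simp add: sum_distrib_left)
    qed
    obtain C where C: "0 \<le> C" "\<And>\<phi> f. \<phi> \<in> H \<Longrightarrow> \<bar>\<phi> f\<bar> \<le> C * norm f"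
      using weak_star_compact_bounded[OF H] by metis
    obtain L where L: "compact L"
      "\<And>f. norm f \<le> 1 \<Longrightarrow> (\<And>x. x \<in> L \<Longrightarrow> apply_bcontfun f x = 0) \<Longrightarrow> \<bar>\<phi> f\<bar> \<le> e / 4"
      using continuous_dual_strict_tight[OF dual, of "e / 4"] e by auto
    \<comment> \<open>The remainder may use \<open>e / 2\<close>: a quarter of \<open>e\<close>
      comes from tightness of \<open>\<phi>\<close> on \<open>L\<close>, another from the bound
      \<open>C * c\<close>.\<close>
    define c where "c = e / (4 * (C + 1))"
    have c: "0 < c" using e C(1) by (simp add: c_def)
    have Cc: "C * c \<le> e / 4" using e C(1) by (simp add: c_def field_simps)
    \<comment> \<open>Only points of \<open>L\<close> where \<open>f\<close> is at least
      \<open>c\<close> need to be removed. They form a compact set disjoint from \<open>K\<close>,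
      so finitely many of the closed neighbourhoods already exclude it.\<close>
    define S where "S = L \<inter> {x. c \<le> \<bar>apply_bcontfun f x\<bar>}"
    have "closed {x. c \<le> \<bar>apply_bcontfun f x\<bar>}" by (intro closed_Collect_le continuous_intros) auto
    then have S: "compact S" unfolding S_def by (rule compact_Int_closed[OF L(1)])
    have disj: "S \<inter> (\<Inter>n. {x. infdist x (F n) \<le> 2 * d n}) = {}"
    proof -
      have "x \<notin> K" if "x \<in> S" for x
      proof
        assume "x \<in> K"
        then show False using f(2)[of x] c that by (simp add: S_def)
      qed
      then show ?thesis unfolding K_def by blast
    qed
    have "\<exists>I. finite I \<and> S \<inter> (\<Inter>n\<in>I. {x. infdist x (F n) \<le> 2 * d n}) = {}"
    proof (rule ccontr)
      assume no: "\<not> ?thesis"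
      have "S \<inter> (\<Inter>n. {x. infdist x (F n) \<le> 2 * d n}) \<noteq> {}"
        by (rule compact_imp_fip_image[OF S])
          (use no in \<open>auto intro!: closed_Collect_le continuous_intros\<close>)
      then show False using disj by blast
    qed
    then obtain I where I: "finite I" "S \<inter> (\<Inter>n\<in>I. {x. infdist x (F n) \<le> 2 * d n}) = {}" by blast
    obtain n where n: "\<And>i. i \<in> I \<Longrightarrow> i < n" using I(1) finite_nat_set_iff_bounded by auto
    have "\<bar>apply_bcontfun (W n) x\<bar> \<le> c" if x: "x \<in> L" for x
    proof (cases "x \<in> S")
      case True
      then obtain i where i: "i \<in> I" "\<not> infdist x (F i) \<le> 2 * d i" using I(2) by blast
      then have "2 * d i \<le> infdist x (F i)" by linarith
      then show ?thesis using W_0[of i n x] n[OF i(1)] c by simp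
    next
      case False
      then show ?thesis using x W_le[of n x] by (simp add: S_def)
    qed
    then have "\<bar>\<phi> (W n)\<bar> \<le> e / 4 + C * c"
      by (intro small_on_compact[where K = L, OF lin C(2)[OF \<phi>] C(1) L(2) normW _ c])
    then have "\<bar>\<phi> (W n)\<bar> \<le> e / 2" using Cc by linarith
    then show ?thesis using sum[of n] geo[of n] by linarith
  qed
  ultimately show "\<exists>K. compact K \<and>
      (\<forall>\<phi>\<in>H. \<forall>f. norm f \<le> 1 \<and> (\<forall>x\<in>K. apply_bcontfun f x = 0) \<longrightarrow> \<bar>\<phi> f\<bar> \<le> e)"
    by blast
qed

text \<open>The supremum of \<open>\<bar>\<phi> f\<bar>\<close> over \<open>H\<close> is a
  norm-bounded tight seminorm, hence lies below one strict seminorm, whose balls serve all of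
  \<open>H\<close> at once. Empty \<open>H\<close> is separate because that supremum would be over
  the empty set.\<close>

lemma weak_star_compact_equicontinuous:
  fixes H :: "(('a::complete_space \<Rightarrow>\<^sub>C real) \<Rightarrow> real) set"
  assumes H: "compactin (weak_star_topology strict_topology) H"
  shows "equicontinuous strict_topology H"
proof (cases "H = {}")
  case True
  have "openin strict_topology (UNIV :: ('a \<Rightarrow>\<^sub>C real) set)"
    using locally_convex_strict openin_topspace unfolding locally_convex_space_def by metis
  then show ?thesis unfolding equicontinuous_def True by blast
next
  case False
  obtain C where C: "0 \<le> C" "\<And>\<phi> f. \<phi> \<in> H \<Longrightarrow> \<bar>\<phi> f\<bar> \<le> C * norm f"
    using weak_star_compact_bounded[OF H] by metis
  note lin = continuous_dual_strict(1)[OF weak_star_compact_dual[OF H]]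
  define p where "p f = (SUP \<phi>\<in>H. \<bar>\<phi> f\<bar>)" for f
  have bdd: "bdd_above ((\<lambda>\<phi>. \<bar>\<phi> f\<bar>) ` H)" for f using C(2) by (intro bdd_aboveI2)
  have le_p: "\<bar>\<phi> f\<bar> \<le> p f" if "\<phi> \<in> H" for \<phi> f unfolding p_def by (rule cSUP_upper[OF that bdd])
  have p_le: "p f \<le> b" if "\<And>\<phi>. \<phi> \<in> H \<Longrightarrow> \<bar>\<phi> f\<bar> \<le> b" for f b
    unfolding p_def by (rule cSUP_least[OF False that])
  have p_nn: "0 \<le> p f" for f using False le_p[of _ f] by (meson abs_ge_zero ex_in_conv order_trans)
  have sc: "p (c *\<^sub>R f) \<le> \<bar>c\<bar> * p f" for c f
    by (rule p_le) (simp add: linear_scale[OF lin] abs_mult mult_left_mono le_p)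
  have "seminorm p"
    unfolding seminorm_def
  proof (intro conjI allI)
    show "0 \<le> p f" for f by (rule p_nn)
    show "p (f + g) \<le> p f + p g" for f g
    proof (rule p_le)
      fix \<phi> assume "\<phi> \<in> H"
      then show "\<bar>\<phi> (f + g)\<bar> \<le> p f + p g"
        using le_p[of \<phi> f] le_p[of \<phi> g] linear_add[OF lin, of \<phi> f g] by linarith
    qed
    show "p (c *\<^sub>R f) = \<bar>c\<bar> * p f" for c f
    proof (cases "c = 0")
      case True
      then show ?thesis using sc[of 0 f] p_nn[of 0] by simp
    next
      case False
      then have "\<bar>c\<bar> * p f \<le> p (c *\<^sub>R f)"
        using mult_left_mono[OF sc[of "1 / c" "c *\<^sub>R f"], of "\<bar>c\<bar>"] by (simp add: abs_mult[symmetric])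
      then show ?thesis using sc[of c f] by simp
    qed
  qed
  moreover have "p f \<le> C * norm f" for f by (rule p_le[OF C(2)])
  moreover have "uniformly_tight {p}"
    unfolding uniformly_tight_def
  proof (intro allI impI)
    fix e :: real assume "0 < e"
    then obtain K where K: "compact K"
      "\<forall>\<phi>\<in>H. \<forall>f. norm f \<le> 1 \<and> (\<forall>x\<in>K. apply_bcontfun f x = 0) \<longrightarrow> \<bar>\<phi> f\<bar> \<le> e"
      using weak_star_compact_tight[OF H] unfolding uniformly_tight_def by metis
    then have "p f \<le> e" if "norm f \<le> 1" "\<forall>x\<in>K. apply_bcontfun f x = 0" for f
      using that by (intro p_le) blast
    then show "\<exists>K. compact K \<and>
        (\<forall>\<phi>\<in>{p}. \<forall>f. norm f \<le> 1 \<and> (\<forall>x\<in>K. apply_bcontfun f x = 0) \<longrightarrow> \<bar>\<phi> f\<bar> \<le> e)"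
      using K(1) p_nn by (intro exI[of _ K]) simp
  qed
  ultimately obtain q where q: "q \<in> strict_seminorms" "\<And>f. p f \<le> q f"
    using tight_seminorm_dominated[of p C] C(1) by metis
  show ?thesis
    unfolding equicontinuous_def
  proof (intro allI impI)
    fix f :: "'a \<Rightarrow>\<^sub>C real" and e :: real assume e: "0 < e"
    have "openin strict_topology {g. q (g - f) < e}"
      unfolding strict_topology_eq by (rule openin_seminorm_topology_ball[OF q(1) e])
    moreover have "f \<in> {g. q (g - f) < e}" using seminorm_zero[OF seminorm_strict[OF q(1)]] e by simp
    moreover have "\<bar>\<phi> g - \<phi> f\<bar> < e" if "\<phi> \<in> H" "q (g - f) < e" for \<phi> g
      using le_p[OF that(1), of "g - f"] q(2)[of "g - f"] that(2) linear_diff[OF lin[OF that(1)], of g f]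
      by linarith
    ultimately show "\<exists>U. openin strict_topology U \<and> f \<in> U \<and> (\<forall>\<phi>\<in>H. \<forall>y\<in>U. \<bar>\<phi> y - \<phi> f\<bar> < e)"
      by (intro exI[of _ "{g. q (g - f) < e}"]) simp
  qed
qed

theorem corollary8p2:
  shows "strong_mackey (strict_topology :: ('a::polish_space \<Rightarrow>\<^sub>C real) topology) \<and>
         condition_C (strict_topology :: ('a \<Rightarrow>\<^sub>C real) topology)"
  unfolding strong_mackey_def
  using locally_convex_strict weak_star_compact_equicontinuous condition_C_strict by blast

end
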